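(* Let $n\in\mathbb{N}$. There is a constant $T=T(n)$ such that for every graph $G$ containing none of the graphs in $\mathcal{F}_{n,1}$ as an induced subgraph, $V(G)$ can be partitioned into $t\le T$ parts $V_1\cup\dots\cup V_t$ such that each $G[V_i]$ is a clique or an independent set, and for all $i\neq j$ the bipartite graph induced between $V_i$ and $V_j$ is $2K_2$-free.
   Context: $G^1_{n,1}=nK_2$ (a matching with $n$ edges, each edge viewed as a star with a centre and a leaf); $G^2_{n,1}$, $G^3_{n,1}$, $G^4_{n,1}$ are obtained from it by adding all edges among the centres, among the leaves, or both, respectively; $H^i_{n,1}$ is the complement of $G^i_{n,1}$; $\mathcal{F}_{n,1}=\{G^i_{n,1},H^i_{n,1}: i=1,\dots,4\}$. The bipartite graph induced between disjoint $V_i,V_j$ has parts $V_i$, $V_j$ and the edges of $G$ between them; $2K_2$-free means it has no induced matching of two edges. *)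

theory Defs
  imports "HOL-Library.Disjoint_Sets" "Graph_Theory.Graph_Theory"
begin

text \<open>
  Finite simple graphs are the symmetric, loop-free, finite digraphs of \<^locale>\<open>pair_graph\<close>:
  an undirected edge is represented by its two opposite arcs.
\<close>

definition contains_induced :: "'a pair_pre_digraph \<Rightarrow> 'b pair_pre_digraph \<Rightarrow> bool" where
  "contains_induced G H \<longleftrightarrow>
     (\<exists>K. induced_subgraph K (with_proj G) \<and> digraph_iso (with_proj H) K)"

definition complement_graph :: "'a pair_pre_digraph \<Rightarrow> 'a pair_pre_digraph" where
  "complement_graph G =
     \<lparr> pverts = pverts G,
       parcs = {(u, v). u \<in> pverts G \<and> v \<in> pverts G \<and> u \<noteq> v \<and> (u, v) \<notin> parcs G} \<rparr>"

definition add_all_edges :: "'a set \<Rightarrow> 'a pair_pre_digraph \<Rightarrow> 'a pair_pre_digraph" where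
  "add_all_edges S G =
     \<lparr> pverts = pverts G, parcs = parcs G \<union> {(u, v). u \<in> S \<and> v \<in> S \<and> u \<noteq> v} \<rparr>"

text \<open>The star number \<open>i\<close> has centre \<open>Inl i\<close> and leaf \<open>Inr i\<close>.\<close>

definition centres :: "nat \<Rightarrow> (nat + nat) set" where
  "centres n = Inl ` {..<n}"

definition leaves :: "nat \<Rightarrow> (nat + nat) set" where
  "leaves n = Inr ` {..<n}"

definition G1 :: "nat \<Rightarrow> (nat + nat) pair_pre_digraph" where
  "G1 n = \<lparr> pverts = centres n \<union> leaves n,
            parcs = (\<Union>i<n. {(Inl i, Inr i), (Inr i, Inl i)}) \<rparr>"

definition G2 :: "nat \<Rightarrow> (nat + nat) pair_pre_digraph" where
  "G2 n = add_all_edges (centres n) (G1 n)"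

definition G3 :: "nat \<Rightarrow> (nat + nat) pair_pre_digraph" where
  "G3 n = add_all_edges (leaves n) (G1 n)"

text \<open>Only edges inside the two sides are added: centres and leaves of different stars stay
  non-adjacent.\<close>

definition G4 :: "nat \<Rightarrow> (nat + nat) pair_pre_digraph" where
  "G4 n = add_all_edges (leaves n) (add_all_edges (centres n) (G1 n))"

definition forbidden_family :: "nat \<Rightarrow> (nat + nat) pair_pre_digraph set" where
  "forbidden_family n =
     {G1 n, G2 n, G3 n, G4 n} \<union> complement_graph ` {G1 n, G2 n, G3 n, G4 n}"

definition induces_clique :: "'a pair_pre_digraph \<Rightarrow> 'a set \<Rightarrow> bool" where
  "induces_clique G V \<longleftrightarrow> complete_digraph (card V) (with_proj G \<restriction> V)"

definition induces_independent :: "'a pair_pre_digraph \<Rightarrow> 'a set \<Rightarrow> bool" where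
  "induces_independent G V \<longleftrightarrow> arcs (with_proj G \<restriction> V) = {}"

definition bipartite_between ::
    "'a pair_pre_digraph \<Rightarrow> 'a set \<Rightarrow> 'a set \<Rightarrow> 'a pair_pre_digraph" where
  "bipartite_between G U W =
     \<lparr> pverts = U \<union> W, parcs = parcs G \<inter> (U \<times> W \<union> W \<times> U) \<rparr>"

definition twoK2_free :: "'a pair_pre_digraph \<Rightarrow> bool" where
  "twoK2_free G \<longleftrightarrow> \<not> contains_induced G (G1 2)"

end

theory Submission
  imports Defs
begin

text \<open>
  First, the vertex set splits into boundedly many homogeneous sets. If some four vertices induce
  \<open>2K\<^sub>2\<close> or its complement \<open>C\<^sub>4\<close>, then every vertex is non-adjacent to both ends of one of two
  disjoint edges or adjacent to both vertices of a non-adjacent pair, and each of the six classes has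
  a smaller induced matching or co-matching number. Otherwise a maximum clique, the vertices missing
  exactly one of its members, and the remaining vertices are homogeneous.

  Second, the bipartite graph between two homogeneous sets \<open>A\<close>, \<open>B\<close> contains no induced matching or
  co-matching with \<open>n\<close> edges. Read it as a bipartite tournament, with an arc from \<open>A\<close> to \<open>B\<close> for an
  edge and from \<open>B\<close> to \<open>A\<close> for a non-edge; a \<open>2K\<^sub>2\<close> is then a directed 4-cycle. Strong components
  can reuse the same colours. In a strong component only consecutive layers \<open>L\<^sub>i\<close>, \<open>L\<^sub>i\<^sub>+\<^sub>1\<close> of the
  distance to a root interact in both directions, so colours modulo 4 reduce to such pairs. For
  \<open>i \<ge> 2\<close>, \<open>L\<^sub>i\<close> is covered by few in-neighbourhoods of vertices \<open>y\<close> in \<open>L\<^sub>i\<^sub>-\<^sub>1\<close>, since a minimal cover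
  is an induced (co-)matching, and an arc from \<open>y\<close> to \<open>L\<^sub>i\<^sub>-\<^sub>2\<close> extends every pattern between that
  in-neighbourhood and \<open>L\<^sub>i\<^sub>+\<^sub>1\<close>, so induction applies.
\<close>

section \<open>Bipartite tournaments\<close>

text \<open>With edges read as arcs from \<open>A\<close> to \<open>B\<close>, the cycle
  \<open>a\<close>, \<open>b\<close>, \<open>a'\<close>, \<open>b'\<close> is an induced 2K2 with
  edges \<open>a b\<close> and \<open>a' b'\<close>. Colours of the two sides are never compared. In
  a bipartite tournament the arcs force \<open>a\<close> and \<open>a'\<close>, and \<open>b\<close>
  and \<open>b'\<close>, to differ.\<close>

definition no_mono_cycle :: "('v \<Rightarrow> 'v \<Rightarrow> bool) \<Rightarrow> 'v set \<Rightarrow> 'v set \<Rightarrow> ('v \<Rightarrow> 'c) \<Rightarrow> bool" where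
  "no_mono_cycle D A B c \<longleftrightarrow>
     (\<forall>a\<in>A. \<forall>a'\<in>A. \<forall>b\<in>B. \<forall>b'\<in>B. c a = c a' \<longrightarrow> c b = c b' \<longrightarrow>
        \<not> (D a b \<and> D b a' \<and> D a' b' \<and> D b' a))"

text \<open>The bound on \<open>c\<close> also holds off \<open>A\<close> and \<open>B\<close>, so
  \<open>T\<close> is positive even for empty sides, and colourings of different pairs combine into
  total functions.\<close>

definition colourable :: "('v \<Rightarrow> 'v \<Rightarrow> bool) \<Rightarrow> 'v set \<Rightarrow> 'v set \<Rightarrow> nat \<Rightarrow> bool" where
  "colourable D A B T \<longleftrightarrow> (\<exists>c :: 'v \<Rightarrow> nat. (\<forall>x. c x < T) \<and> no_mono_cycle D A B c)"

text \<open>An induced matching or co-matching, depending on which side comes first.\<close>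

definition pattern :: "('v \<Rightarrow> 'v \<Rightarrow> bool) \<Rightarrow> 'v set \<Rightarrow> 'v set \<Rightarrow> nat \<Rightarrow> bool" where
  "pattern D A B k \<longleftrightarrow>
     (\<exists>a b. \<forall>i<k. a i \<in> A \<and> b i \<in> B \<and> (\<forall>j<k. D (a i) (b j) \<longleftrightarrow> i = j))"

definition bip_tournament :: "('v \<Rightarrow> 'v \<Rightarrow> bool) \<Rightarrow> 'v set \<Rightarrow> 'v set \<Rightarrow> bool" where
  "bip_tournament D A B \<longleftrightarrow>
     finite A \<and> finite B \<and> A \<inter> B = {} \<and> (\<forall>a\<in>A. \<forall>b\<in>B. D a b \<longleftrightarrow> \<not> D b a)"

section \<open>Colourings built from colourings of smaller pairs\<close>

lemma no_mono_cycle_sym: "no_mono_cycle D A B c \<Longrightarrow> no_mono_cycle D B A c"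
  unfolding no_mono_cycle_def by metis

lemma no_mono_cycle_conversep: "no_mono_cycle D A B c \<Longrightarrow> no_mono_cycle D\<inverse>\<inverse> A B c"
  unfolding no_mono_cycle_def by (metis conversepD)

lemma colourable_sym: "colourable D A B T \<Longrightarrow> colourable D B A T"
  unfolding colourable_def using no_mono_cycle_sym by blast

lemma colourable_conversep: "colourable D\<inverse>\<inverse> A B T \<longleftrightarrow> colourable D A B T"
  unfolding colourable_def using no_mono_cycle_conversep by (metis conversep_conversep)

lemma colourable_mono:
  assumes "colourable D A B T" "A' \<subseteq> A" "B' \<subseteq> B" "T \<le> T'"
  shows "colourable D A' B' T'"
proof -
  obtain c :: "_ \<Rightarrow> nat" where "\<forall>x. c x < T" "no_mono_cycle D A B c"
    using assms(1) unfolding colourable_def by blast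
  then have "(\<forall>x. c x < T') \<and> no_mono_cycle D A' B' c"
    using assms(2-4) unfolding no_mono_cycle_def by (meson in_mono order_less_le_trans)
  then show ?thesis
    unfolding colourable_def by blast
qed

lemma colourable_empty:
  assumes "A = {} \<or> B = {}" "0 < T"
  shows "colourable D A B T"
  unfolding colourable_def no_mono_cycle_def
  using assms by (intro exI[of _ "\<lambda>_. 0"]) auto

lemma colourable_pos: "colourable D A B T \<Longrightarrow> 0 < T"
  unfolding colourable_def by (metis gr0I not_less0)

text \<open>Only equality of colours matters, so tuples and functions from a finite set
  \<open>S\<close> may serve as colours.\<close>

lemma colourableI:
  assumes "no_mono_cycle D A B h" "\<And>x. h x \<in> S" "finite S" "card S \<le> T"
  shows "colourable D A B T"
proof -
  obtain e where e: "bij_betw e S {0..<card S}"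
    using ex_bij_betw_finite_nat[OF assms(3)] by blast
  then have "e (h x) < T" for x
    using bij_betwE[OF e] assms(2,4) by (meson atLeastLessThan_iff order_less_le_trans)
  moreover have "e (h x) = e (h y) \<longleftrightarrow> h x = h y" for x y
    using e assms(2) by (metis bij_betw_imp_inj_on inj_on_eq_iff)
  ultimately have "(\<forall>x. (e \<circ> h) x < T) \<and> no_mono_cycle D A B (e \<circ> h)"
    using assms(1) unfolding no_mono_cycle_def by simp
  then show ?thesis
    unfolding colourable_def by blast
qed

text \<open>A 4-cycle that is monochromatic for \<open>h\<close> has its \<open>A\<close>-vertices
  in one class of \<open>f\<close> and its \<open>B\<close>-vertices in one class, so the colouring
  chosen for that pair of classes excludes it. One value of \<open>f\<close> and one colour for each
  of the \<open>k * k\<close> pairs give the count.\<close>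

lemma colourable_refine:
  assumes f: "\<And>x. f x < k"
    and col: "\<And>i j. i < k \<Longrightarrow> j < k \<Longrightarrow> colourable D {x \<in> A. f x = i} {x \<in> B. f x = j} T"
  shows "colourable D A B (k * T ^ (k * k))"
proof -
  let ?I = "{..<k} \<times> {..<k}"
  have "\<forall>ij\<in>?I. \<exists>c :: _ \<Rightarrow> nat. (\<forall>x. c x < T) \<and>
      no_mono_cycle D {x \<in> A. f x = fst ij} {x \<in> B. f x = snd ij} c"
  proof
    fix ij assume "ij \<in> ?I"
    then have "colourable D {x \<in> A. f x = fst ij} {x \<in> B. f x = snd ij} T"
      using col[of "fst ij" "snd ij"] by auto
    then show "\<exists>c :: _ \<Rightarrow> nat. (\<forall>x. c x < T) \<and>
        no_mono_cycle D {x \<in> A. f x = fst ij} {x \<in> B. f x = snd ij} c"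
      unfolding colourable_def .
  qed
  from bchoice[OF this] obtain C where C0: "\<forall>ij\<in>?I. (\<forall>x. C ij x < T) \<and>
      no_mono_cycle D {x \<in> A. f x = fst ij} {x \<in> B. f x = snd ij} (C ij)"
    by blast
  then have C: "\<And>ij x. ij \<in> ?I \<Longrightarrow> C ij x < T"
    "\<And>ij. ij \<in> ?I \<Longrightarrow> no_mono_cycle D {x \<in> A. f x = fst ij} {x \<in> B. f x = snd ij} (C ij)"
    by blast+
  \<comment> \<open>The restriction puts the second component into a finite function space with
    \<open>T ^ (k * k)\<close> elements.\<close>
  define h where "h x = (f x, restrict (\<lambda>ij. C ij x) ?I)" for x
  have hD: "f x = f y \<and> (\<forall>ij\<in>?I. C ij x = C ij y)" if "h x = h y" for x y
  proof -
    have "f x = f y" and *: "restrict (\<lambda>ij. C ij x) ?I = restrict (\<lambda>ij. C ij y) ?I"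
      using that unfolding h_def by blast+
    moreover have "C ij x = C ij y" if "ij \<in> ?I" for ij
      using fun_cong[OF *, of ij] that by (simp only: restrict_apply')
    ultimately show ?thesis
      by blast
  qed
  show ?thesis
  proof (rule colourableI)
    show "no_mono_cycle D A B h"
      unfolding no_mono_cycle_def
    proof (intro ballI impI)
      fix a a' b b' assume *: "a \<in> A" "a' \<in> A" "b \<in> B" "b' \<in> B" "h a = h a'" "h b = h b'"
      have I: "(f a, f b) \<in> ?I"
        using f by simp
      have "f a' = f a" "f b' = f b" "C (f a, f b) a = C (f a, f b) a'" "C (f a, f b) b = C (f a, f b) b'"
        using hD[OF *(5)] hD[OF *(6)] I by auto
      with C(2)[OF I] *(1-4) show "\<not> (D a b \<and> D b a' \<and> D a' b' \<and> D b' a)"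
        unfolding no_mono_cycle_def by simp
    qed
    show "h x \<in> {..<k} \<times> (?I \<rightarrow>\<^sub>E {..<T})" for x
      unfolding h_def using f C(1) by auto
    show "finite ({..<k} \<times> (?I \<rightarrow>\<^sub>E {..<T}))"
      by (intro finite_cartesian_product finite_PiE) auto
    show "card ({..<k} \<times> (?I \<rightarrow>\<^sub>E {..<T})) \<le> k * T ^ (k * k)"
      by (simp add: card_PiE card_cartesian_product)
  qed
qed

text \<open>The level is weakly increasing along arcs, so a directed cycle stays inside one level.\<close>

lemma colourable_levels:
  fixes m :: "'v \<Rightarrow> nat"
  assumes m: "\<And>a b. a \<in> A \<Longrightarrow> b \<in> B \<Longrightarrow> D a b \<Longrightarrow> m a \<le> m b"
    "\<And>a b. a \<in> A \<Longrightarrow> b \<in> B \<Longrightarrow> D b a \<Longrightarrow> m b \<le> m a"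
    and col: "\<And>i. colourable D {x \<in> A. m x = i} {x \<in> B. m x = i} T"
  shows "colourable D A B T"
proof -
  have "\<forall>i. \<exists>c :: 'v \<Rightarrow> nat. (\<forall>x. c x < T) \<and> no_mono_cycle D {x \<in> A. m x = i} {x \<in> B. m x = i} c"
    using col unfolding colourable_def by blast
  from choice[OF this] obtain C :: "nat \<Rightarrow> 'v \<Rightarrow> nat" where C: "\<And>i x. C i x < T"
    "\<And>i. no_mono_cycle D {x \<in> A. m x = i} {x \<in> B. m x = i} (C i)"
    by blast
  have "no_mono_cycle D A B (\<lambda>x. C (m x) x)"
    unfolding no_mono_cycle_def
  proof (intro ballI impI notI)
    fix a a' b b'
    assume *: "a \<in> A" "a' \<in> A" "b \<in> B" "b' \<in> B" "C (m a) a = C (m a') a'" "C (m b) b = C (m b') b'"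
      and cyc: "D a b \<and> D b a' \<and> D a' b' \<and> D b' a"
    have "m a \<le> m b" "m b \<le> m a'" "m a' \<le> m b'" "m b' \<le> m a"
      using m * cyc by blast+
    then have eq: "m b = m a" "m a' = m a" "m b' = m a"
      by linarith+
    have "\<not> (D a b \<and> D b a' \<and> D a' b' \<and> D b' a)"
      by (rule C(2)[of "m a", unfolded no_mono_cycle_def, rule_format])
        (use * eq in simp_all)
    then show False
      using cyc by blast
  qed
  moreover have "\<forall>x. C (m x) x < T"
    using C(1) by blast
  ultimately show ?thesis
    unfolding colourable_def by (intro exI[of _ "\<lambda>x. C (m x) x"]) blast
qed

text \<open>Adding \<open>4 - s\<close> moves the residues \<open>s\<close> and \<open>s + 1\<close>
  to 0 and 1, so that division by 4 then groups two consecutive layers into one block.\<close>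

lemma mod4_shift:
  fixes s x :: nat
  assumes "s < 4" "x mod 4 = s \<or> x mod 4 = (s + 1) mod 4"
  shows "(x + (4 - s)) mod 4 \<le> 1"
proof -
  have *: "(y + (4 - s)) mod 4 \<le> 1"
    if "s = 0 \<or> s = 1 \<or> s = 2 \<or> s = 3" "y = s \<or> y = (s + 1) mod 4" for y
    using that by (elim disjE; clarsimp)
  have "(x + (4 - s)) mod 4 = (x mod 4 + (4 - s)) mod 4"
    by (rule mod_add_left_eq[symmetric])
  also have "\<dots> \<le> 1"
    by (rule *[OF _ assms(2)]) (use assms(1) in linarith)
  finally show ?thesis .
qed

text \<open>An even and an odd residue modulo 4 are neighbours, so the layers with these residues
  form blocks of two consecutive layers. Distinct blocks are at least 3 layers apart while an arc
  descends at most one layer. Hence no arc leads to a lower block, and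
  \<open>colourable_levels\<close> leaves single blocks. The exponent 16 counts pairs of
  residues.\<close>

lemma colourable_layers:
  fixes l :: "'v \<Rightarrow> nat"
  assumes par: "\<And>a. a \<in> A \<Longrightarrow> even (l a)" "\<And>b. b \<in> B \<Longrightarrow> odd (l b)"
    and arc: "\<And>a b. a \<in> A \<Longrightarrow> b \<in> B \<Longrightarrow> D a b \<Longrightarrow> l a \<le> Suc (l b)"
    "\<And>a b. a \<in> A \<Longrightarrow> b \<in> B \<Longrightarrow> D b a \<Longrightarrow> l b \<le> Suc (l a)"
    and col: "\<And>i. colourable D {x \<in> A. l x = i \<or> l x = Suc i} {x \<in> B. l x = i \<or> l x = Suc i} T"
  shows "colourable D A B (4 * T ^ 16)"
proof -
  have T: "0 < T"
    using col colourable_pos by blast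
  have consec: "colourable D {x \<in> A. l x mod 4 = u} {x \<in> B. l x mod 4 = v} T"
    if uv: "u < 4" "v < 4" "u = s \<and> v = (s + 1) mod 4 \<or> v = s \<and> u = (s + 1) mod 4" "s < 4" for u v s
  proof (rule colourable_levels[where m = "\<lambda>x. (l x + (4 - s)) div 4"])
    have rem: "(x + (4 - s)) mod 4 \<le> 1" if "x mod 4 = u \<or> x mod 4 = v" for x
      using that uv(3) by (intro mod4_shift[OF \<open>s < 4\<close>]) auto
    have mono: "(x + (4 - s)) div 4 \<le> (y + (4 - s)) div 4"
      if "x \<le> Suc y" "x mod 4 = u \<and> y mod 4 = v \<or> x mod 4 = v \<and> y mod 4 = u" for x y :: nat
      using that rem[of x] rem[of y] mult_div_mod_eq[of 4 "x + (4 - s)"]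
        mult_div_mod_eq[of 4 "y + (4 - s)"] by linarith
    show "(l a + (4 - s)) div 4 \<le> (l b + (4 - s)) div 4"
      if "a \<in> {x \<in> A. l x mod 4 = u}" "b \<in> {x \<in> B. l x mod 4 = v}" "D a b" for a b
      using mono arc(1) that by simp
    show "(l b + (4 - s)) div 4 \<le> (l a + (4 - s)) div 4"
      if "a \<in> {x \<in> A. l x mod 4 = u}" "b \<in> {x \<in> B. l x mod 4 = v}" "D b a" for a b
      using mono arc(2) that by simp
    fix i
    \<comment> \<open>For \<open>i = 0\<close> only \<open>x = 0\<close> with \<open>s = 3\<close>
      can occur, and the truncated difference is then 0 as well.\<close>
    have lev: "x = 4 * i - (4 - s) \<or> x = Suc (4 * i - (4 - s))"
      if x: "x mod 4 = u \<or> x mod 4 = v" and i: "(x + (4 - s)) div 4 = i" for x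
    proof (cases "x + (4 - s) = 4 * i")
      case False
      then have "x + (4 - s) = Suc (4 * i)"
        using i rem[OF x] mult_div_mod_eq[of 4 "x + (4 - s)"] by linarith
      then show ?thesis
        using \<open>s < 4\<close> by (cases i) linarith+
    qed linarith
    show "colourable D {x \<in> {x \<in> A. l x mod 4 = u}. (l x + (4 - s)) div 4 = i}
        {x \<in> {x \<in> B. l x mod 4 = v}. (l x + (4 - s)) div 4 = i} T"
    proof (rule colourable_mono[OF col[of "4 * i - (4 - s)"]])
      show "{x \<in> {x \<in> A. l x mod 4 = u}. (l x + (4 - s)) div 4 = i}
          \<subseteq> {x \<in> A. l x = 4 * i - (4 - s) \<or> l x = Suc (4 * i - (4 - s))}"
        "{x \<in> {x \<in> B. l x mod 4 = v}. (l x + (4 - s)) div 4 = i}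
          \<subseteq> {x \<in> B. l x = 4 * i - (4 - s) \<or> l x = Suc (4 * i - (4 - s))}"
        using lev by blast+
    qed simp
  qed
  have "colourable D A B (4 * T ^ (4 * 4))"
  proof (rule colourable_refine[where f = "\<lambda>x. l x mod 4"])
    fix i j :: nat assume ij: "i < 4" "j < 4"
    show "colourable D {x \<in> A. l x mod 4 = i} {x \<in> B. l x mod 4 = j} T"
    proof (cases "even i \<and> odd j")
      case True
      have "i = 0 \<or> i = 1 \<or> i = 2 \<or> i = 3" "j = 0 \<or> j = 1 \<or> j = 2 \<or> j = 3"
        using ij by linarith+
      then have "j = (i + 1) mod 4 \<or> i = (j + 1) mod 4"
        using True by (elim disjE; simp)
      then show ?thesis
        using consec ij by blast
    next
      \<comment> \<open>\<open>A\<close> lies on even layers and \<open>B\<close> on odd ones, so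
        any other parities leave one side empty.\<close>
      case False
      have "odd (l x mod 4) = odd (l x)" for x
        by (simp add: dvd_mod_iff)
      then have "{x \<in> A. l x mod 4 = i} = {} \<or> {x \<in> B. l x mod 4 = j} = {}"
        using False par by blast
      then show ?thesis
        using T by (rule colourable_empty)
    qed
  qed simp
  then show ?thesis
    by simp
qed

section \<open>Patterns and small covers\<close>

lemma patternI:
  assumes "\<And>i. i < k \<Longrightarrow> a i \<in> A" "\<And>i. i < k \<Longrightarrow> b i \<in> B"
    "\<And>i j. i < k \<Longrightarrow> j < k \<Longrightarrow> D (a i) (b j) \<longleftrightarrow> i = j"
  shows "pattern D A B k"
  unfolding pattern_def using assms by blast

lemma patternE:
  assumes "pattern D A B k"
  obtains a b where "\<forall>i<k. a i \<in> A" "\<forall>i<k. b i \<in> B" "\<forall>i<k. \<forall>j<k. D (a i) (b j) \<longleftrightarrow> i = j"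
  using assms unfolding pattern_def by blast

lemma pattern_antimono:
  assumes "pattern D A' B' k'" "A' \<subseteq> A" "B' \<subseteq> B" "k \<le> k'"
  shows "pattern D A B k"
proof -
  obtain a b where "\<forall>i<k'. a i \<in> A'" "\<forall>i<k'. b i \<in> B'"
    "\<forall>i<k'. \<forall>j<k'. D (a i) (b j) \<longleftrightarrow> i = j"
    using assms(1) by (rule patternE)
  then show ?thesis
    using assms(2-4) by (intro patternI[of k a A b B D]) auto
qed

lemma pattern_conversep: "pattern D\<inverse>\<inverse> A B k \<longleftrightarrow> pattern D B A k"
  unfolding pattern_def conversep_iff by (rule iffI; elim exE; metis)

text \<open>Used contrapositively: if patterns of size \<open>Suc k\<close> are excluded on
  \<open>A\<close> and \<open>B\<close>, such an arc from \<open>u\<close> to \<open>v\<close>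
  excludes size \<open>k\<close> on \<open>A'\<close> and \<open>B'\<close>, which feeds the
  induction.\<close>

lemma pattern_extend:
  assumes "pattern D A' B' k" "A' \<subseteq> A" "B' \<subseteq> B" "u \<in> A" "v \<in> B" "D u v"
    "\<And>b. b \<in> B' \<Longrightarrow> \<not> D u b" "\<And>a. a \<in> A' \<Longrightarrow> \<not> D a v"
  shows "pattern D A B (Suc k)"
proof -
  obtain a b where ab: "\<forall>i<k. a i \<in> A'" "\<forall>i<k. b i \<in> B'"
    "\<forall>i<k. \<forall>j<k. D (a i) (b j) \<longleftrightarrow> i = j"
    using assms(1) by (rule patternE)
  show ?thesis
  proof (rule patternI)
    fix i j assume "i < Suc k" "j < Suc k"
    then consider "i < k" "j < k" | "i = k" "j < k" | "i < k" "j = k" | "i = k" "j = k"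
      by linarith
    then show "D ((a(k := u)) i) ((b(k := v)) j) \<longleftrightarrow> i = j"
      by cases (use ab assms(6-8) in auto)
  qed (use ab assms(2-5) in \<open>auto simp: less_Suc_eq\<close>)
qed

text \<open>In a minimal cover every member has a private vertex, which makes it a pattern.\<close>

lemma small_cover:
  assumes "finite Y" "\<forall>x\<in>X. \<exists>y\<in>Y. D x y" "\<not> pattern D X Y p"
  obtains C where "C \<subseteq> Y" "card C < p" "\<forall>x\<in>X. \<exists>y\<in>C. D x y"
proof -
  let ?cov = "\<lambda>C. C \<subseteq> Y \<and> (\<forall>x\<in>X. \<exists>y\<in>C. D x y)"
  obtain C where C: "?cov C" and min: "\<And>C'. ?cov C' \<Longrightarrow> card C \<le> card C'"
    using ex_has_least_nat[of ?cov Y card] assms(2) by auto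
  have finC: "finite C"
    using C assms(1) finite_subset by blast
  have "\<exists>x\<in>X. D x y \<and> (\<forall>y'\<in>C. D x y' \<longrightarrow> y' = y)" if "y \<in> C" for y
  proof (rule ccontr)
    assume "\<not> ?thesis"
    then have "?cov (C - {y})"
      using C by blast
    then have "card C \<le> card (C - {y})"
      by (rule min)
    then show False
      using that finC by (metis card_Diff1_less leD)
  qed
  then obtain w where w: "\<And>y. y \<in> C \<Longrightarrow> w y \<in> X \<and> D (w y) y \<and> (\<forall>y'\<in>C. D (w y) y' \<longrightarrow> y' = y)"
    by metis
  obtain e where "bij_betw e {0..<card C} C"
    using ex_bij_betw_nat_finite[OF finC] by blast
  then have e: "\<And>i. i < card C \<Longrightarrow> e i \<in> C" "inj_on e {0..<card C}"
    by (auto simp: bij_betw_def)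
  then have eq: "e i = e j \<longleftrightarrow> i = j" if "i < card C" "j < card C" for i j
    using that by (meson atLeastLessThan_iff inj_on_eq_iff zero_le)
  have "pattern D X Y (card C)"
  proof (rule patternI)
    fix i j assume ij: "i < card C" "j < card C"
    then show "D (w (e i)) (e j) \<longleftrightarrow> i = j"
      using w e(1) eq by metis
  qed (use w e C in auto)
  then have "card C < p"
    using assms(3) pattern_antimono not_less by blast
  then show ?thesis
    using that C by blast
qed

text \<open>In the application \<open>X\<close> and \<open>W\<close> are the layers \<open>i\<close>
  and \<open>i + 1\<close>, and \<open>Y\<close> and \<open>Z\<close> are the layers
  \<open>i - 1\<close> and \<open>i - 2\<close>; the names \<open>S\<close> and \<open>S'\<close>
  for the sides serve both parities of \<open>i\<close>. A cover by fewer than \<open>p\<close>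
  in-neighbourhoods splits \<open>X\<close>. The part sending arcs to \<open>y\<close> receives none
  from \<open>y\<close>, and \<open>W\<close> sends none to \<open>Z\<close>, so an arc from
  \<open>y\<close> into \<open>Z\<close> extends any pattern from \<open>W\<close> to that part.
  Thus size \<open>q\<close> is excluded there and \<open>IH\<close> applies.\<close>

lemma colourable_far_pair:
  assumes fin: "finite Y" and T: "0 < T" and pN: "p \<le> N"
    and sub: "X \<subseteq> S" "Z \<subseteq> S" "Y \<subseteq> S'" "W \<subseteq> S'"
    and asym: "\<And>s t. s \<in> S \<Longrightarrow> t \<in> S' \<Longrightarrow> D s t \<longleftrightarrow> \<not> D t s"
    and XY: "\<And>x. x \<in> X \<Longrightarrow> \<exists>y\<in>Y. D x y"
    and YZ: "\<And>y. y \<in> Y \<Longrightarrow> \<exists>z\<in>Z. D y z"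
    and ZW: "\<And>z w. z \<in> Z \<Longrightarrow> w \<in> W \<Longrightarrow> \<not> D w z"
    and p: "\<not> pattern D S S' p" and q: "\<not> pattern D S' S (Suc q)"
    and IH: "\<And>A B. A \<subseteq> S \<Longrightarrow> B \<subseteq> S' \<Longrightarrow> \<not> pattern D B A q \<Longrightarrow> colourable D A B T"
  shows "colourable D X W (N * T ^ (N * N))"
proof -
  have "\<forall>x\<in>X. \<exists>y\<in>Y. D x y"
    using XY by blast
  moreover have "\<not> pattern D X Y p"
    using pattern_antimono[OF _ sub(1) sub(3) order_refl] p by blast
  ultimately obtain C where C: "C \<subseteq> Y" "card C < p" "\<forall>x\<in>X. \<exists>y\<in>C. D x y"
    by (rule small_cover[OF fin])
  have finC: "finite C"
    using C(1) fin finite_subset by blast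
  obtain e where "bij_betw e {0..<card C} C"
    using ex_bij_betw_nat_finite[OF finC] by blast
  then have e: "e ` {0..<card C} = C"
    by (simp add: bij_betw_def)
  then have "\<forall>x\<in>X. \<exists>i<card C. D x (e i)"
    using C(3) by (metis atLeastLessThan_iff imageE)
  from bchoice[OF this] obtain g where g: "\<And>x. x \<in> X \<Longrightarrow> g x < card C \<and> D x (e (g x))"
    by blast
  \<comment> \<open>The value 0 off \<open>X\<close> stays below \<open>N\<close> because
    \<open>card C < p\<close> makes \<open>p\<close>, and so \<open>N\<close>, positive.\<close>
  define f where "f x = (if x \<in> X then g x else 0)" for x
  show ?thesis
  proof (rule colourable_refine[where f = f])
    show "f x < N" for x
      using g[of x] C(2) pN unfolding f_def by (cases "x \<in> X") simp_all
    fix i j :: nat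
    show "colourable D {x \<in> X. f x = i} {x \<in> W. f x = j} T"
    proof (cases "{x \<in> X. f x = i} = {}")
      case True
      then show ?thesis
        using T colourable_empty by blast
    next
      \<comment> \<open>A nonempty class guarantees that \<open>i\<close> is below
        \<open>card C\<close>, so \<open>e i\<close> really belongs to the cover.\<close>
      case False
      then have i: "e i \<in> C" "\<And>x. x \<in> X \<Longrightarrow> f x = i \<Longrightarrow> D x (e i)"
        using g e unfolding f_def by auto
      obtain z where z: "z \<in> Z" "D (e i) z"
        using YZ i(1) C(1) by blast
      have ei: "e i \<in> S'" and zS: "z \<in> S"
        using i(1) C(1) sub(2,3) z(1) by auto
      have subs: "{x \<in> X. f x = i} \<subseteq> S" "{x \<in> W. f x = j} \<subseteq> S'"
        using sub(1,4) by auto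
      have "\<not> pattern D {x \<in> W. f x = j} {x \<in> X. f x = i} q"
      proof
        assume *: "pattern D {x \<in> W. f x = j} {x \<in> X. f x = i} q"
        have "pattern D S' S (Suc q)"
        proof (rule pattern_extend[OF * subs(2,1) ei zS z(2)])
          show "\<not> D (e i) x" if "x \<in> {x \<in> X. f x = i}" for x
            using i(2)[of x] asym[OF _ ei, of x] subs(1) that by auto
          show "\<not> D w z" if "w \<in> {x \<in> W. f x = j}" for w
            using ZW[OF z(1), of w] that by simp
        qed
        then show False
          using q by contradiction
      qed
      then show ?thesis
        by (rule IH[OF subs])
    qed
  qed
qed

section \<open>Distance layers and strong components\<close>

definition reducible :: "('v \<Rightarrow> 'v \<Rightarrow> bool) \<Rightarrow> 'v set \<Rightarrow> 'v set \<Rightarrow> nat \<Rightarrow> nat \<Rightarrow> nat \<Rightarrow> bool" where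
  "reducible D A B p q T \<longleftrightarrow>
     bip_tournament D A B \<and> \<not> pattern D A B (Suc p) \<and> \<not> pattern D B A (Suc q) \<and> 0 < T \<and>
     (\<forall>A' B'. A' \<subseteq> A \<longrightarrow> B' \<subseteq> B \<longrightarrow> \<not> pattern D A' B' p \<or> \<not> pattern D B' A' q \<longrightarrow>
        colourable D A' B' T)"

text \<open>An axiomatic form of the directed distance to a root in \<open>A\<close>, free of paths
  so that it serves \<open>D\<close> and its converse alike. Arcs may raise the level by any
  amount.\<close>

definition layering :: "('v \<Rightarrow> 'v \<Rightarrow> bool) \<Rightarrow> 'v set \<Rightarrow> 'v set \<Rightarrow> ('v \<Rightarrow> nat) \<Rightarrow> bool" where
  "layering D A B l \<longleftrightarrow>
     (\<forall>a\<in>A. even (l a)) \<and> (\<forall>b\<in>B. odd (l b)) \<and>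
     (\<forall>a\<in>A. \<forall>b\<in>B. (D a b \<longrightarrow> l a \<le> Suc (l b)) \<and> (D b a \<longrightarrow> l b \<le> Suc (l a))) \<and>
     (\<forall>a\<in>A. \<forall>i. l a = Suc i \<longrightarrow> (\<exists>b\<in>B. D a b \<and> l b = i)) \<and>
     (\<forall>b\<in>B. \<forall>i. l b = Suc i \<longrightarrow> (\<exists>a\<in>A. D b a \<and> l a = i))"

text \<open>\<open>D\<close> is arbitrary inside each side, so reachability must use only arcs
  between the sides.\<close>

definition cross_arc :: "('v \<Rightarrow> 'v \<Rightarrow> bool) \<Rightarrow> 'v set \<Rightarrow> 'v set \<Rightarrow> 'v \<Rightarrow> 'v \<Rightarrow> bool" where
  "cross_arc D A B x y \<longleftrightarrow> D x y \<and> (x \<in> A \<and> y \<in> B \<or> x \<in> B \<and> y \<in> A)"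

lemma cross_arc_conversep: "cross_arc D\<inverse>\<inverse> A B = (cross_arc D A B)\<inverse>\<inverse>"
  unfolding cross_arc_def fun_eq_iff by auto

lemma bip_tournament_conversep: "bip_tournament D A B \<Longrightarrow> bip_tournament D\<inverse>\<inverse> A B"
  unfolding bip_tournament_def by simp

lemma bip_tournament_subset:
  "bip_tournament D A B \<Longrightarrow> A' \<subseteq> A \<Longrightarrow> B' \<subseteq> B \<Longrightarrow> bip_tournament D A' B'"
  unfolding bip_tournament_def by (meson disjoint_iff finite_subset subsetD)

text \<open>\<open>reducible\<close> packages the induction hypothesis: \<open>T\<close> serves
  every subpair on which one of the two excluded sizes has dropped by one. Reversing arcs exchanges
  patterns from \<open>A\<close> to \<open>B\<close> with those from \<open>B\<close> to
  \<open>A\<close>, hence the exchange of \<open>p\<close> and \<open>q\<close>.\<close>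

lemma reducible_conversep:
  assumes "reducible D A B p q T"
  shows "reducible D\<inverse>\<inverse> A B q p T"
  using assms bip_tournament_conversep[of D A B]
  unfolding reducible_def pattern_conversep colourable_conversep by blast

text \<open>Since \<open>i\<close> is at least 2, the two lower layers used by
  \<open>colourable_far_pair\<close> exist. The parity of \<open>i\<close> decides which side holds
  layer \<open>i\<close>; for odd \<open>i\<close> the sides and the roles of \<open>p\<close> and
  \<open>q\<close> are exchanged.\<close>

lemma colourable_far_layers:
  assumes red: "reducible D A B p q T" and lay: "layering D A B l"
    and N: "Suc p \<le> N" "Suc q \<le> N" and i: "2 \<le> i"
  shows "colourable D {x \<in> A. l x = i \<or> l x = Suc i} {x \<in> B. l x = i \<or> l x = Suc i} (N * T ^ (N * N))"
proof -
  obtain k where k: "i = Suc (Suc k)"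
    using i by (metis Suc_le_D numeral_2_eq_2 Suc_le_mono)
  have tour: "finite A" "finite B" "A \<inter> B = {}" "\<And>a b. a \<in> A \<Longrightarrow> b \<in> B \<Longrightarrow> D a b \<longleftrightarrow> \<not> D b a"
    and T: "0 < T" and pat: "\<not> pattern D A B (Suc p)" "\<not> pattern D B A (Suc q)"
    and IH: "\<And>A' B'. A' \<subseteq> A \<Longrightarrow> B' \<subseteq> B \<Longrightarrow> \<not> pattern D A' B' p \<or> \<not> pattern D B' A' q \<Longrightarrow>
        colourable D A' B' T"
    using red unfolding reducible_def bip_tournament_def by blast+
  have par: "\<And>a. a \<in> A \<Longrightarrow> even (l a)" "\<And>b. b \<in> B \<Longrightarrow> odd (l b)"
    and arc: "\<And>a b. a \<in> A \<Longrightarrow> b \<in> B \<Longrightarrow> D a b \<Longrightarrow> l a \<le> Suc (l b)"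
      "\<And>a b. a \<in> A \<Longrightarrow> b \<in> B \<Longrightarrow> D b a \<Longrightarrow> l b \<le> Suc (l a)"
    and nxt: "\<And>a i. a \<in> A \<Longrightarrow> l a = Suc i \<Longrightarrow> \<exists>b\<in>B. D a b \<and> l b = i"
      "\<And>b i. b \<in> B \<Longrightarrow> l b = Suc i \<Longrightarrow> \<exists>a\<in>A. D b a \<and> l a = i"
    using lay unfolding layering_def by blast+
  show ?thesis
  proof (cases "even i")
    case True
    have eq: "{x \<in> A. l x = i \<or> l x = Suc i} = {x \<in> A. l x = i}"
      "{x \<in> B. l x = i \<or> l x = Suc i} = {x \<in> B. l x = Suc i}"
      using par True by fastforce+
    have "colourable D {x \<in> A. l x = i} {x \<in> B. l x = Suc i} (N * T ^ (N * N))"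
    proof (rule colourable_far_pair[where S = A and S' = B and p = "Suc p" and q = q
            and Y = "{x \<in> B. l x = Suc k}" and Z = "{x \<in> A. l x = k}"])
      show "\<exists>y\<in>{x \<in> B. l x = Suc k}. D x y" if "x \<in> {x \<in> A. l x = i}" for x
        using nxt(1)[of x "Suc k"] that k by auto
      show "\<exists>z\<in>{x \<in> A. l x = k}. D y z" if "y \<in> {x \<in> B. l x = Suc k}" for y
        using nxt(2)[of y k] that by auto
      show "\<not> D w z" if "z \<in> {x \<in> A. l x = k}" "w \<in> {x \<in> B. l x = Suc i}" for w z
        using arc(2)[of z w] that k by auto
      show "colourable D A' B' T" if "A' \<subseteq> A" "B' \<subseteq> B" "\<not> pattern D B' A' q" for A' B'
        using IH that by blast
    qed (use tour T N pat in auto)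
    then show ?thesis
      unfolding eq .
  next
    case False
    have eq: "{x \<in> A. l x = i \<or> l x = Suc i} = {x \<in> A. l x = Suc i}"
      "{x \<in> B. l x = i \<or> l x = Suc i} = {x \<in> B. l x = i}"
      using par False by fastforce+
    have "colourable D {x \<in> B. l x = i} {x \<in> A. l x = Suc i} (N * T ^ (N * N))"
    proof (rule colourable_far_pair[where S = B and S' = A and p = "Suc q" and q = p
            and Y = "{x \<in> A. l x = Suc k}" and Z = "{x \<in> B. l x = k}"])
      show "\<exists>y\<in>{x \<in> A. l x = Suc k}. D x y" if "x \<in> {x \<in> B. l x = i}" for x
        using nxt(2)[of x "Suc k"] that k by auto
      show "\<exists>z\<in>{x \<in> B. l x = k}. D y z" if "y \<in> {x \<in> A. l x = Suc k}" for y
        using nxt(1)[of y k] that by auto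
      show "\<not> D w z" if "z \<in> {x \<in> B. l x = k}" "w \<in> {x \<in> A. l x = Suc i}" for w z
        using arc(1)[of w z] that k by auto
      show "colourable D B' A' T" if "B' \<subseteq> B" "A' \<subseteq> A" "\<not> pattern D A' B' p" for A' B'
        by (rule colourable_sym, rule IH) (use that in blast)+
      show "D s t \<longleftrightarrow> \<not> D t s" if "s \<in> B" "t \<in> A" for s t
        using tour(4)[OF that(2,1)] by blast
    qed (use tour(1,2) T N pat in auto)
    then show ?thesis
      unfolding eq by (rule colourable_sym)
  qed
qed

text \<open>The first two pairs of layers are handled by the layering away from the root: a vertex
  of \<open>B\<close> cannot be in the first layer of both.\<close>

lemma colourable_two_layerings:
  assumes red: "reducible D A B p q T"
    and lay: "layering D A B l" "layering D\<inverse>\<inverse> A B l'"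
    and root: "\<And>a. a \<in> A \<Longrightarrow> l a = 0 \<Longrightarrow> a = r" "\<And>a. a \<in> A \<Longrightarrow> l' a = 0 \<Longrightarrow> a = r"
    and N: "Suc p \<le> N" "Suc q \<le> N"
  shows "colourable D A B (4 * (4 * (N * T ^ (N * N)) ^ 16) ^ 16)"
\<comment> \<open>The outer \<open>4 * _ ^ 16\<close> comes from the layers of \<open>l\<close>, the
  inner one from the layers of \<open>l'\<close> inside two layers of \<open>l\<close>, and
  \<open>N * T ^ (N * N)\<close> from a pair of layers away from the root.\<close>
proof (rule colourable_layers[where l = l])
  let ?T = "N * T ^ (N * N)"
  have T: "0 < T"
    using red unfolding reducible_def by blast
  then have T1: "0 < ?T"
    using N by simp
  have tour: "\<And>a b. a \<in> A \<Longrightarrow> b \<in> B \<Longrightarrow> D a b \<longleftrightarrow> \<not> D b a"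
    using red unfolding reducible_def bip_tournament_def by blast
  note L = lay[unfolded layering_def conversep_iff]
  show "\<And>a. a \<in> A \<Longrightarrow> even (l a)" "\<And>b. b \<in> B \<Longrightarrow> odd (l b)"
    "\<And>a b. a \<in> A \<Longrightarrow> b \<in> B \<Longrightarrow> D a b \<Longrightarrow> l a \<le> Suc (l b)"
    "\<And>a b. a \<in> A \<Longrightarrow> b \<in> B \<Longrightarrow> D b a \<Longrightarrow> l b \<le> Suc (l a)"
    using L(1) by blast+
  fix i
  show "colourable D {x \<in> A. l x = i \<or> l x = Suc i} {x \<in> B. l x = i \<or> l x = Suc i} (4 * ?T ^ 16)"
    (is "colourable D ?A ?B _")
  proof (cases "2 \<le> i")
    case True
    have "?T \<le> ?T ^ 16"
      using T1 by (intro self_le_power) auto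
    then have "?T \<le> 4 * ?T ^ 16"
      by linarith
    then show ?thesis
      using colourable_mono[OF colourable_far_layers[OF red lay(1) N True]] by blast
  next
    case False
    have "colourable D\<inverse>\<inverse> ?A ?B (4 * ?T ^ 16)"
    proof (rule colourable_layers[where l = l'])
      show "\<And>a. a \<in> ?A \<Longrightarrow> even (l' a)" "\<And>b. b \<in> ?B \<Longrightarrow> odd (l' b)"
        "\<And>a b. a \<in> ?A \<Longrightarrow> b \<in> ?B \<Longrightarrow> D\<inverse>\<inverse> a b \<Longrightarrow> l' a \<le> Suc (l' b)"
        "\<And>a b. a \<in> ?A \<Longrightarrow> b \<in> ?B \<Longrightarrow> D\<inverse>\<inverse> b a \<Longrightarrow> l' b \<le> Suc (l' a)"
        using L(2) by auto
      fix j
      show "colourable D\<inverse>\<inverse> {x \<in> ?A. l' x = j \<or> l' x = Suc j} {x \<in> ?B. l' x = j \<or> l' x = Suc j} ?T"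
      proof (cases "2 \<le> j")
        case True
        show ?thesis
          by (rule colourable_mono[OF colourable_far_layers[OF reducible_conversep[OF red] lay(2) N(2,1) True]])
            auto
      next
        case j: False
        have "{x \<in> ?B. l' x = j \<or> l' x = Suc j} = {}"
        proof (rule ccontr)
          assume "\<not> ?thesis"
          then obtain b where b: "b \<in> B" "l b = i \<or> l b = Suc i" "l' b = j \<or> l' b = Suc j"
            by blast
          have "odd (l b)" "odd (l' b)"
            using L b(1) by blast+
          moreover have "l b = 0 \<or> l b = 1 \<or> l b = 2" "l' b = 0 \<or> l' b = 1 \<or> l' b = 2"
            using b(2,3) False j by linarith+
          ultimately have "l b = Suc 0" "l' b = Suc 0"
            by auto
          \<comment> \<open>Level 1 is the only odd level up to 2. Both \<open>a\<close> and
            \<open>a'\<close> equal the root \<open>r\<close>, which would then have arcs to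
            \<open>b\<close> and from \<open>b\<close>.\<close>
          then obtain a a' where "a \<in> A" "D b a" "l a = 0" "a' \<in> A" "D a' b" "l' a' = 0"
            using L b(1) by blast
          then show False
            using root tour b(1) by blast
        qed
        then show ?thesis
          using T1 colourable_empty by blast
      qed
    qed
    then show ?thesis
      unfolding colourable_conversep .
  qed
qed

text \<open>The level is the length of a shortest directed path to \<open>r\<close>. Each arc
  changes sides, so the side of the start fixes the parity of every path to
  \<open>r\<close>.\<close>

lemma ex_layering:
  assumes "r \<in> A" "A \<inter> B = {}"
    and reach: "\<And>x. x \<in> A \<union> B \<Longrightarrow> (cross_arc D A B)\<^sup>*\<^sup>* x r"
  shows "\<exists>l. layering D A B l \<and> (\<forall>a\<in>A. l a = 0 \<longrightarrow> a = r)"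
proof -
  let ?R = "cross_arc D A B"
  define l where "l x = (LEAST n. (?R ^^ n) x r)" for x
  have l: "(?R ^^ l x) x r" if "x \<in> A \<union> B" for x
    using reach[OF that] unfolding l_def rtranclp_power by (rule LeastI_ex)
  have l_le: "l x \<le> n" if "(?R ^^ n) x r" for x n
    using that unfolding l_def by (rule Least_le)
  have side: "(x \<in> A \<longrightarrow> even n) \<and> (x \<in> B \<longrightarrow> odd n)" if "(?R ^^ n) x r" for n x
    using that
  proof (induction n arbitrary: x)
    case 0
    then show ?case
      using assms(1,2) by auto
  next
    case (Suc n)
    then obtain y where "?R x y" "(?R ^^ n) y r"
      by (meson relpowp_Suc_D2)
    then show ?case
      using Suc.IH[of y] assms(2) unfolding cross_arc_def by auto
  qed
  have arc: "l x \<le> Suc (l y)" if "?R x y" for x y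
    using that by (intro l_le relpowp_Suc_I2[OF _ l]) (auto simp: cross_arc_def)
  have nxt: "\<exists>y. ?R x y \<and> l y = i" if x: "x \<in> A \<union> B" "l x = Suc i" for x i
  proof -
    obtain y where y: "?R x y" "(?R ^^ i) y r"
      using l[OF x(1)] unfolding x(2) by (meson relpowp_Suc_D2)
    \<comment> \<open>The rest of the path gives the upper bound, and the arc from \<open>x\<close>,
      which has level \<open>Suc i\<close>, gives the lower one.\<close>
    have "l y = i"
      using l_le[OF y(2)] arc[OF y(1)] x(2) by simp
    then show ?thesis
      using y(1) by blast
  qed
  have "layering D A B l"
    unfolding layering_def
  proof (intro conjI ballI allI impI)
    show "\<exists>b\<in>B. D a b \<and> l b = i" if "a \<in> A" "l a = Suc i" for a i
      using nxt[of a i] that assms(2) unfolding cross_arc_def by blast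
    show "\<exists>a\<in>A. D b a \<and> l a = i" if "b \<in> B" "l b = Suc i" for b i
      using nxt[of b i] that assms(2) unfolding cross_arc_def by blast
  qed (use side l arc in \<open>auto simp: cross_arc_def\<close>)
  moreover have "a = r" if "a \<in> A" "l a = 0" for a
    using l[of a] that by simp
  ultimately show ?thesis
    by blast
qed

text \<open>No arc enters \<open>U\<close> from outside, so a directed cycle stays on one side of
  the cut and both parts reuse the same \<open>T\<close> colours. Repeated splitting reaches strong
  components without raising the bound.\<close>

lemma colourable_split:
  assumes "\<And>x y. cross_arc D A B x y \<Longrightarrow> y \<in> U \<Longrightarrow> x \<in> U"
    and "colourable D (A \<inter> U) (B \<inter> U) T" "colourable D (A - U) (B - U) T"
  shows "colourable D A B T"
proof (rule colourable_levels[where m = "\<lambda>x. if x \<in> U then 0 else 1"])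
  have T: "0 < T"
    using assms(2) by (rule colourable_pos)
  fix i :: nat
  have "{x \<in> X. (if x \<in> U then 0 else 1) = i} = (if i = 0 then X \<inter> U else if i = 1 then X - U else {})"
    for X :: "'a set"
    by auto
  then show "colourable D {x \<in> A. (if x \<in> U then 0 else 1) = i} {x \<in> B. (if x \<in> U then 0 else 1) = i} T"
    using assms(2,3) colourable_empty[OF _ T, of "{}" "{}" D] by simp
qed (use assms(1) in \<open>auto simp: cross_arc_def\<close>)

text \<open>The outer induction is on a bound for \<open>p + q\<close>, the inner one on the number
  of vertices with \<open>T'\<close> fixed. A pair that is not strongly connected splits into
  smaller pairs with the same \<open>T'\<close>; in a strongly connected one the layerings towards
  and away from \<open>r\<close> use the outer hypothesis.\<close>

lemma bip_tournament_colourable: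
  "\<exists>T. \<forall>(D :: 'v \<Rightarrow> 'v \<Rightarrow> bool) A B p q. p + q \<le> s \<longrightarrow> bip_tournament D A B \<longrightarrow>
     \<not> pattern D A B p \<longrightarrow> \<not> pattern D B A q \<longrightarrow> colourable D A B T"
proof (induction s)
  case 0
  have "pattern D A B 0" for D :: "'v \<Rightarrow> 'v \<Rightarrow> bool" and A B
    unfolding pattern_def by blast
  then show ?case
    by auto
next
  case (Suc s)
  then obtain T0 where T0: "\<And>(D :: 'v \<Rightarrow> 'v \<Rightarrow> bool) A B p q. p + q \<le> s \<Longrightarrow> bip_tournament D A B \<Longrightarrow>
     \<not> pattern D A B p \<Longrightarrow> \<not> pattern D B A q \<Longrightarrow> colourable D A B T0"
    by blast
  \<comment> \<open>\<open>T0\<close> may be 0 if its hypotheses are never met, while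
    \<open>reducible\<close> demands a positive bound.\<close>
  define T where "T = Suc T0"
  define N where "N = Suc s"
  define T' where "T' = 4 * (4 * (N * T ^ (N * N)) ^ 16) ^ 16"
  have "0 < T'"
    unfolding T'_def T_def N_def by simp
  have "colourable D A B T'"
    if "p + q \<le> Suc s" "bip_tournament D A B" "\<not> pattern D A B p" "\<not> pattern D B A q"
    for D :: "'v \<Rightarrow> 'v \<Rightarrow> bool" and A B p q
    using that(2-)
  proof (induction "card (A \<union> B)" arbitrary: A B rule: less_induct)
    case less
    note tour = less.prems(1)
    have fin: "finite (A \<union> B)" and disj: "A \<inter> B = {}"
      using tour unfolding bip_tournament_def by auto
    have sub: "colourable D A' B' T'" if "A' \<subseteq> A" "B' \<subseteq> B" "A' \<union> B' \<noteq> A \<union> B" for A' B'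
    proof (rule less.hyps)
      have "A' \<union> B' \<subset> A \<union> B"
        using that by blast
      then show "card (A' \<union> B') < card (A \<union> B)"
        using fin by (rule psubset_card_mono[rotated])
      show "bip_tournament D A' B'"
        using tour that(1,2) by (rule bip_tournament_subset)
      show "\<not> pattern D A' B' p" "\<not> pattern D B' A' q"
        using less.prems(2,3) pattern_antimono[OF _ that(1,2) order_refl]
          pattern_antimono[OF _ that(2,1) order_refl] by blast+
    qed
    show ?case
    proof (cases "A = {}")
      case True
      then show ?thesis
        using \<open>0 < T'\<close> colourable_empty by blast
    next
      case False
      then obtain r where r: "r \<in> A"
        by blast
      let ?R = "cross_arc D A B"
      consider x where "x \<in> A \<union> B" "\<not> ?R\<^sup>*\<^sup>* x r" | x where "x \<in> A \<union> B" "\<not> ?R\<^sup>*\<^sup>* r x"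
        | "\<And>x. x \<in> A \<union> B \<Longrightarrow> ?R\<^sup>*\<^sup>* x r" "\<And>x. x \<in> A \<union> B \<Longrightarrow> ?R\<^sup>*\<^sup>* r x"
        by blast
      then show ?thesis
      proof cases
        case (1 x)
        show ?thesis
        \<comment> \<open>\<open>U\<close> contains \<open>r\<close> but not \<open>x\<close>, so
          both parts are proper.\<close>
        proof (rule colourable_split[where U = "{x. ?R\<^sup>*\<^sup>* x r}"])
          show "x \<in> {x. ?R\<^sup>*\<^sup>* x r}" if "?R x y" "y \<in> {x. ?R\<^sup>*\<^sup>* x r}" for x y
            using that by (simp add: converse_rtranclp_into_rtranclp)
        qed (rule sub; use 1 r in auto)+
      next
        case (2 x)
        show ?thesis
        \<comment> \<open>This time \<open>U\<close> contains \<open>x\<close> but not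
          \<open>r\<close>.\<close>
        proof (rule colourable_split[where U = "{x. \<not> ?R\<^sup>*\<^sup>* r x}"])
          show "x \<in> {x. \<not> ?R\<^sup>*\<^sup>* r x}" if "?R x y" "y \<in> {x. \<not> ?R\<^sup>*\<^sup>* r x}" for x y
            using that by (meson mem_Collect_eq rtranclp.rtrancl_into_rtrancl)
        qed (rule sub; use 2 r in auto)+
      next
        case 3
        obtain p' q' where pq: "p = Suc p'" "q = Suc q'"
          using less.prems(2,3) unfolding pattern_def by (metis not0_implies_Suc not_less_zero)
        have red: "reducible D A B p' q' T"
          unfolding reducible_def
        proof (intro conjI allI impI)
          fix A' B' assume AB: "A' \<subseteq> A" "B' \<subseteq> B"
            and *: "\<not> pattern D A' B' p' \<or> \<not> pattern D B' A' q'"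
          have "bip_tournament D A' B'"
            using tour AB by (rule bip_tournament_subset)
          moreover have "\<not> pattern D A' B' p" "\<not> pattern D B' A' q"
            using less.prems(2,3) pattern_antimono[OF _ AB order_refl]
              pattern_antimono[OF _ AB(2,1) order_refl] by blast+
          \<comment> \<open>The excluded sizes may be taken as \<open>p'\<close> and
            \<open>q\<close> or as \<open>p\<close> and \<open>q'\<close>; either sum is at most
            \<open>s\<close>.\<close>
          ultimately have "colourable D A' B' T0"
            using * T0[of p' q D A' B'] T0[of p q' D A' B'] \<open>p + q \<le> Suc s\<close> unfolding pq by auto
          then show "colourable D A' B' T"
            by (rule colourable_mono) (auto simp: T_def)
        qed (use tour less.prems(2,3) in \<open>auto simp: pq T_def\<close>)
        obtain l where l: "layering D A B l" "\<forall>a\<in>A. l a = 0 \<longrightarrow> a = r"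
          using ex_layering[OF r disj 3(1)] by blast
        have "(cross_arc D\<inverse>\<inverse> A B)\<^sup>*\<^sup>* x r" if "x \<in> A \<union> B" for x
          using 3(2)[OF that] unfolding cross_arc_conversep rtranclp_conversep by simp
        then obtain l' where l': "layering D\<inverse>\<inverse> A B l'" "\<forall>a\<in>A. l' a = 0 \<longrightarrow> a = r"
          using ex_layering[OF r disj] by blast
        show ?thesis
          unfolding T'_def
          by (rule colourable_two_layerings[OF red l(1) l'(1)])
            (use l(2) l'(2) \<open>p + q \<le> Suc s\<close> in \<open>auto simp: pq N_def\<close>)
      qed
    qed
  qed
  then show ?case
    by blast
qed

section \<open>Homogeneous partitions\<close>

definition homogeneous :: "('v \<Rightarrow> 'v \<Rightarrow> bool) \<Rightarrow> 'v set \<Rightarrow> bool" where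
  "homogeneous E V \<longleftrightarrow> (\<forall>x\<in>V. \<forall>y\<in>V. x \<noteq> y \<longrightarrow> E x y) \<or> (\<forall>x\<in>V. \<forall>y\<in>V. \<not> E x y)"

text \<open>\<open>T\<close> is an upper bound for the cochromatic number of the graph on
  \<open>V\<close>.\<close>

definition cocolourable :: "('v \<Rightarrow> 'v \<Rightarrow> bool) \<Rightarrow> 'v set \<Rightarrow> nat \<Rightarrow> bool" where
  "cocolourable E V T \<longleftrightarrow>
     (\<exists>c :: 'v \<Rightarrow> nat. (\<forall>x. c x < T) \<and> (\<forall>k. homogeneous E {x \<in> V. c x = k}))"

text \<open>The adjacencies alone force the \<open>2 * k\<close> vertices to be distinct. For
  \<open>co E\<close> with a simple \<open>E\<close>, the \<open>a i\<close> and the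
  \<open>b i\<close> form two cliques, and the only non-adjacent cross pairs are \<open>a i\<close>,
  \<open>b i\<close>.\<close>

definition induced_matching :: "('v \<Rightarrow> 'v \<Rightarrow> bool) \<Rightarrow> 'v set \<Rightarrow> nat \<Rightarrow> bool" where
  "induced_matching E V k \<longleftrightarrow>
     (\<exists>a b. (\<forall>i<k. a i \<in> V) \<and> (\<forall>i<k. b i \<in> V) \<and>
        (\<forall>i<k. \<forall>j<k. (E (a i) (b j) \<longleftrightarrow> i = j) \<and> \<not> E (a i) (a j) \<and> \<not> E (b i) (b j)))"

definition co :: "('v \<Rightarrow> 'v \<Rightarrow> bool) \<Rightarrow> 'v \<Rightarrow> 'v \<Rightarrow> bool" where
  "co E x y \<longleftrightarrow> x \<noteq> y \<and> \<not> E x y"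

definition simple_rel :: "('v \<Rightarrow> 'v \<Rightarrow> bool) \<Rightarrow> bool" where
  "simple_rel E \<longleftrightarrow> (\<forall>x y. E x y \<longrightarrow> E y x) \<and> (\<forall>x. \<not> E x x)"

text \<open>Applied to \<open>co E\<close> for a simple \<open>E\<close>, this describes an induced
  C4.\<close>

definition has_2K2 :: "('v \<Rightarrow> 'v \<Rightarrow> bool) \<Rightarrow> 'v set \<Rightarrow> bool" where
  "has_2K2 E V \<longleftrightarrow>
     (\<exists>a\<in>V. \<exists>b\<in>V. \<exists>c\<in>V. \<exists>d\<in>V. E a b \<and> E c d \<and> \<not> E a c \<and> \<not> E a d \<and> \<not> E b c \<and> \<not> E b d)"

lemma simple_rel_co: "simple_rel E \<Longrightarrow> simple_rel (co E)"
  unfolding simple_rel_def co_def by metis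

lemma co_co: "simple_rel E \<Longrightarrow> co (co E) = E"
  unfolding simple_rel_def co_def fun_eq_iff by metis

lemma homogeneous_co: "simple_rel E \<Longrightarrow> homogeneous (co E) V = homogeneous E V"
  unfolding simple_rel_def co_def homogeneous_def by metis

lemma cocolourable_co: "simple_rel E \<Longrightarrow> cocolourable (co E) V T = cocolourable E V T"
  unfolding cocolourable_def by (simp add: homogeneous_co)

lemma homogeneous_subset: "homogeneous E V \<Longrightarrow> W \<subseteq> V \<Longrightarrow> homogeneous E W"
  unfolding homogeneous_def by (meson subsetD)

lemma cocolourable_mono:
  assumes "cocolourable E V T" "W \<subseteq> V" "T \<le> T'"
  shows "cocolourable E W T'"
proof -
  obtain c :: "_ \<Rightarrow> nat" where c: "\<forall>x. c x < T" "\<forall>k. homogeneous E {x \<in> V. c x = k}"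
    using assms(1) unfolding cocolourable_def by blast
  have "homogeneous E {x \<in> W. c x = k}" for k
    by (rule homogeneous_subset[OF c(2)[rule_format, of k]]) (use assms(2) in auto)
  moreover have "c x < T'" for x
    using c(1) assms(3) by (meson order_less_le_trans)
  ultimately show ?thesis
    unfolding cocolourable_def by blast
qed

lemma cocolourable_cover:
  assumes f: "\<And>x. f x < k" and col: "\<And>i. i < k \<Longrightarrow> cocolourable E {x \<in> V. f x = i} T"
  shows "cocolourable E V (k * T)"
proof -
  have "\<forall>i\<in>{..<k}. \<exists>c :: _ \<Rightarrow> nat. (\<forall>x. c x < T) \<and> (\<forall>j. homogeneous E {x \<in> {x \<in> V. f x = i}. c x = j})"
    using col unfolding cocolourable_def by simp
  from bchoice[OF this] obtain C :: "nat \<Rightarrow> _ \<Rightarrow> nat" where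
    C: "\<forall>i\<in>{..<k}. (\<forall>x. C i x < T) \<and> (\<forall>j. homogeneous E {x \<in> {x \<in> V. f x = i}. C i x = j})"
    by blast
  \<comment> \<open>Class and inner colour are coded as quotient and remainder modulo
    \<open>T\<close>.\<close>
  define c where "c x = f x * T + C (f x) x" for x
  have C_less: "C (f x) x < T" for x
    using C f by simp
  have hom: "homogeneous E {x \<in> V. c x = j}" for j
  proof (rule homogeneous_subset)
    have "f x = j div T \<and> C (j div T) x = j mod T" if "c x = j" for x
      using that C_less[of x] unfolding c_def by auto
    then show "{x \<in> V. c x = j} \<subseteq> {x \<in> {x \<in> V. f x = j div T}. C (j div T) x = j mod T}"
      by blast
    show "homogeneous E {x \<in> {x \<in> V. f x = j div T}. C (j div T) x = j mod T}"
    proof (cases "j div T < k")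
      case True
      then show ?thesis
        using C by simp
    next
      \<comment> \<open>Nothing is known about \<open>C\<close> at such an index, but the class is
        empty.\<close>
      case False
      then have "f x \<noteq> j div T" for x
        using f[of x] by auto
      then show ?thesis
        by (simp add: homogeneous_def)
    qed
  qed
  have "c x < k * T" for x
  proof -
    have "c x < Suc (f x) * T"
      using C_less[of x] unfolding c_def by simp
    also have "\<dots> \<le> k * T"
      using f[of x] by (intro mult_le_mono1) simp
    finally show ?thesis .
  qed
  then show ?thesis
    unfolding cocolourable_def using hom by blast
qed

section \<open>Induced matchings and bounded cocolourings\<close>

lemma induced_matching_0: "induced_matching E V 0"
  unfolding induced_matching_def by simp

lemma induced_matchingE:
  assumes "induced_matching E V k"
  obtains a b where "\<forall>i<k. a i \<in> V" "\<forall>i<k. b i \<in> V"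
    "\<forall>i<k. \<forall>j<k. E (a i) (b j) \<longleftrightarrow> i = j"
    "\<forall>i<k. \<forall>j<k. \<not> E (a i) (a j)" "\<forall>i<k. \<forall>j<k. \<not> E (b i) (b j)"
proof -
  obtain a b where "\<forall>i<k. a i \<in> V" "\<forall>i<k. b i \<in> V"
    "\<forall>i<k. \<forall>j<k. (E (a i) (b j) \<longleftrightarrow> i = j) \<and> \<not> E (a i) (a j) \<and> \<not> E (b i) (b j)"
    using assms unfolding induced_matching_def by blast
  then show ?thesis
    by (intro that[of a b]) blast+
qed

lemma induced_matching_antimono:
  assumes "induced_matching E V k" "V \<subseteq> W"
  shows "induced_matching E W k"
proof -
  obtain a b where "\<forall>i<k. a i \<in> V" "\<forall>i<k. b i \<in> V"
    "\<forall>i<k. \<forall>j<k. (E (a i) (b j) \<longleftrightarrow> i = j) \<and> \<not> E (a i) (a j) \<and> \<not> E (b i) (b j)"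
    using assms(1) unfolding induced_matching_def by blast
  then show ?thesis
    unfolding induced_matching_def using assms(2)
    by - (rule exI[of _ a], rule exI[of _ b], auto)
qed

text \<open>Contrapositively, the vertices missing both ends of an edge have a smaller induced
  matching number. For \<open>co E\<close> the same holds for the common neighbours of a
  non-adjacent pair.\<close>

lemma induced_matching_extend:
  assumes E: "simple_rel E" and uv: "E u v" "u \<in> V" "v \<in> V"
    and M: "induced_matching E {x \<in> V. \<not> E x u \<and> \<not> E x v} k"
  shows "induced_matching E V (Suc k)"
proof -
  obtain a b where ab: "\<forall>i<k. a i \<in> {x \<in> V. \<not> E x u \<and> \<not> E x v}"
    "\<forall>i<k. b i \<in> {x \<in> V. \<not> E x u \<and> \<not> E x v}"
    "\<forall>i<k. \<forall>j<k. (E (a i) (b j) \<longleftrightarrow> i = j) \<and> \<not> E (a i) (a j) \<and> \<not> E (b i) (b j)"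
    using M unfolding induced_matching_def by blast
  have sym: "E x y \<longleftrightarrow> E y x" and irr: "\<not> E x x" for x y
    using E unfolding simple_rel_def by blast+
  let ?a = "a(k := u)" and ?b = "b(k := v)"
  have "(E (?a i) (?b j) \<longleftrightarrow> i = j) \<and> \<not> E (?a i) (?a j) \<and> \<not> E (?b i) (?b j)"
    if ij: "i < Suc k" "j < Suc k" for i j
  proof -
    consider "i < k" "j < k" | "i = k" "j < k" | "i < k" "j = k" | "i = k" "j = k"
      using ij by linarith
    then show ?thesis
    proof cases
      case 1
      then show ?thesis
        using ab(3) by simp
    next
      case 2
      then show ?thesis
        using ab(1,2) sym[of u] sym[of v] by simp
    next
      case 3
      then show ?thesis
        using ab(1,2) by simp
    next
      case 4
      then show ?thesis
        using uv(1) irr by simp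
    qed
  qed
  moreover have "\<forall>i<Suc k. ?a i \<in> V" "\<forall>i<Suc k. ?b i \<in> V"
    using ab(1,2) uv(2,3) by (simp_all add: less_Suc_eq)
  ultimately show ?thesis
    unfolding induced_matching_def by blast
qed

text \<open>An edge inside \<open>Z\<close> or inside the rest would enlarge the maximum clique
  \<open>K\<close>, or close up with two members of \<open>K\<close> to an induced C4 or
  2K2.\<close>

lemma cocolourable_2K2_free:
  assumes fin: "finite V" and E: "simple_rel E"
    and no_2K2: "\<not> has_2K2 E V" and no_C4: "\<not> has_2K2 (co E) V"
  shows "cocolourable E V 3"
proof -
  have sym: "E x y \<Longrightarrow> E y x" and irr: "\<not> E x x" for x y
    using E unfolding simple_rel_def by blast+
  have C4: False if "E x y" "E y z" "E z w" "E w x" "\<not> E x z" "\<not> E y w" "x \<noteq> z" "y \<noteq> w"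
    "x \<in> V" "y \<in> V" "z \<in> V" "w \<in> V" for x y z w
  proof -
    have "has_2K2 (co E) V"
      unfolding has_2K2_def co_def
      by (rule bexI[of _ x], rule bexI[of _ z], rule bexI[of _ y], rule bexI[of _ w])
        (use that sym[OF that(2)] sym[OF that(4)] in auto)
    then show False
      using no_C4 by contradiction
  qed
  let ?clique = "\<lambda>K. K \<subseteq> V \<and> (\<forall>x\<in>K. \<forall>y\<in>K. x \<noteq> y \<longrightarrow> E x y)"
  have bound: "\<forall>K. ?clique K \<longrightarrow> card K < Suc (card V)"
    using card_mono[OF fin] by (simp add: less_Suc_eq_le)
  have "\<exists>K. ?clique K \<and> (\<forall>K'. ?clique K' \<longrightarrow> card K' \<le> card K)"
    by (rule ex_has_greatest_nat[OF _ bound, of "{}"]) simp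
  then obtain K where K: "?clique K" and max: "\<And>K'. ?clique K' \<Longrightarrow> card K' \<le> card K"
    by blast
  have finK: "finite K"
    using K fin finite_subset by blast
  define Z where "Z = {x \<in> V - K. \<exists>u\<in>K. \<not> E x u \<and> (\<forall>w\<in>K. w \<noteq> u \<longrightarrow> E x w)}"
  have Z: "\<not> E z z'" if zZ: "z \<in> Z" "z' \<in> Z" for z z'
  proof
    assume zz: "E z z'"
    obtain u where u: "u \<in> K" "\<not> E z u" "\<forall>w\<in>K. w \<noteq> u \<longrightarrow> E z w"
      using zZ(1) unfolding Z_def by blast
    obtain u' where u': "u' \<in> K" "\<not> E z' u'" "\<forall>w\<in>K. w \<noteq> u' \<longrightarrow> E z' w"
      using zZ(2) unfolding Z_def by blast
    have zV: "z \<in> V" "z' \<in> V" "z \<notin> K" "z' \<notin> K" "z \<noteq> z'"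
      using zZ zz irr[of z] unfolding Z_def by auto
    show False
    proof (cases "u = u'")
      case True
      \<comment> \<open>Exchanging the commonly missed \<open>u\<close> for \<open>z\<close> and
        \<open>z'\<close> gives a larger clique.\<close>
      have "?clique (insert z (insert z' (K - {u})))"
      proof (intro conjI ballI impI)
        show "insert z (insert z' (K - {u})) \<subseteq> V"
          using K zV by auto
        fix x y assume "x \<in> insert z (insert z' (K - {u}))" "y \<in> insert z (insert z' (K - {u}))" "x \<noteq> y"
        moreover have "E z k \<and> E k z \<and> E z' k \<and> E k z'" if "k \<in> K - {u}" for k
          using that u(3) u'(3) True sym by blast
        ultimately show "E x y"
          using K zz sym[OF zz] by auto
      qed
      then have "card (insert z (insert z' (K - {u}))) \<le> card K"
        by (rule max)
      moreover have "card (insert z (insert z' (K - {u}))) = Suc (card K)"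
        using zV finK card_Suc_Diff1[OF finK u(1)] by (simp del: card_Diff_singleton card_Diff_insert)
      ultimately show False
        by simp
    next
      case False
      \<comment> \<open>Here \<open>z\<close>, \<open>u'\<close>, \<open>u\<close>,
        \<open>z'\<close> is an induced 4-cycle.\<close>
      have "E z u'" "E z' u" "E u' u"
        using False u u' K by auto
      then show False
        using C4[of z u' u z'] sym[OF zz] sym[of z' u] u(1,2) u'(1) zV K sym[of u' z'] u'(2) by blast
    qed
  qed
  have miss: "\<exists>u\<in>K. \<exists>w\<in>K. u \<noteq> w \<and> \<not> E x u \<and> \<not> E x w" if x: "x \<in> V - K - Z" for x
  proof -
    have "\<exists>u\<in>K. \<not> E x u"
    proof (rule ccontr)
      assume "\<not> ?thesis"
      then have "?clique (insert x K)"
        using K x sym by auto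
      then have "card (insert x K) \<le> card K"
        by (rule max)
      then show False
        using x finK by simp
    qed
    then show ?thesis
      using x unfolding Z_def by blast
  qed
  have rest: "\<not> E x y" if xy: "x \<in> V - K - Z" "y \<in> V - K - Z" for x y
  proof
    assume e: "E x y"
    have less: False
      if x: "x \<in> V - K - Z" and y: "y \<in> V - K - Z" and e: "E x y" and le: "\<forall>k\<in>K. E x k \<longrightarrow> E y k" for x y
    proof -
      obtain u w where uw: "u \<in> K" "w \<in> K" "u \<noteq> w" "\<not> E y u" "\<not> E y w"
        using miss[OF y] by blast
      \<comment> \<open>By \<open>le\<close>, the members \<open>u\<close> and \<open>w\<close>
        missed by \<open>y\<close> are missed by \<open>x\<close> too, so the edges
        \<open>x y\<close> and \<open>u w\<close> form an induced 2K2.\<close>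
      have "has_2K2 E V"
        unfolding has_2K2_def
        by (rule bexI[of _ x], rule bexI[of _ y], rule bexI[of _ u], rule bexI[of _ w])
          (use uw x y e le K in auto)
      then show False
        using no_2K2 by contradiction
    qed
    show False
    proof (cases "(\<forall>k\<in>K. E x k \<longrightarrow> E y k) \<or> (\<forall>k\<in>K. E y k \<longrightarrow> E x k)")
      case True
      then show False
        using less[OF xy e] less[OF xy(2,1) sym[OF e]] by blast
    next
      case False
      then obtain k k' where k: "k \<in> K" "E x k" "\<not> E y k" "k' \<in> K" "E y k'" "\<not> E x k'"
        by blast
      \<comment> \<open>Incomparable neighbourhoods in \<open>K\<close> give the induced 4-cycle
        \<open>x\<close>, \<open>k\<close>, \<open>k'\<close>, \<open>y\<close>.\<close>
      have mem: "x \<noteq> k'" "k \<noteq> y" "x \<in> V" "k \<in> V" "k' \<in> V" "y \<in> V"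
        using k xy K by auto
      have "E k k'"
        using k K by auto
      moreover have "\<not> E k y"
        using k(3) sym by blast
      ultimately show False
        using C4[OF k(2) _ sym[OF k(5)] sym[OF e] k(6) _ mem] by simp
    qed
  qed
  define c :: "_ \<Rightarrow> nat" where "c x = (if x \<in> K then 0 else if x \<in> Z then 1 else 2)" for x
  have "homogeneous E {x \<in> V. c x = k}" for k
  proof -
    have "{x \<in> V. c x = k} \<subseteq> K \<or> {x \<in> V. c x = k} \<subseteq> Z \<or> {x \<in> V. c x = k} \<subseteq> V - K - Z"
      unfolding c_def by auto
    moreover have "homogeneous E K" "homogeneous E Z" "homogeneous E (V - K - Z)"
      unfolding homogeneous_def using K Z rest by blast+
    ultimately show ?thesis
      using homogeneous_subset by blast
  qed
  moreover have "c x < 3" for x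
    unfolding c_def by simp
  ultimately show ?thesis
    unfolding cocolourable_def by blast
qed

text \<open>A vertex adjacent to an end of each edge has a neighbour among \<open>a\<close>,
  \<open>b\<close> and one among \<open>c\<close>, \<open>d\<close>, and these two are non-adjacent.
  Two edges and four cross pairs give the factor 6; \<open>induced_matching_extend\<close> lowers
  \<open>p\<close> for the edges and \<open>q\<close> for the cross pairs.\<close>

lemma cocolourable_2K2:
  assumes E: "simple_rel E" and M: "\<not> induced_matching E V (Suc p)" "\<not> induced_matching (co E) V (Suc q)"
    and IH: "\<And>W. W \<subseteq> V \<Longrightarrow> \<not> induced_matching E W p \<Longrightarrow> cocolourable E W T"
      "\<And>W. W \<subseteq> V \<Longrightarrow> \<not> induced_matching (co E) W q \<Longrightarrow> cocolourable E W T"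
    and "has_2K2 E V"
  shows "cocolourable E V (6 * T)"
proof -
  obtain a b c d where abcd: "a \<in> V" "b \<in> V" "c \<in> V" "d \<in> V" "E a b" "E c d"
    "\<not> E a c" "\<not> E a d" "\<not> E b c" "\<not> E b d"
    using assms(6) unfolding has_2K2_def by blast
  have sym: "E x y \<Longrightarrow> E y x" and irr: "\<not> E x x" for x y
    using E unfolding simple_rel_def by blast+
  have edge: "cocolourable E {x \<in> V. \<not> E x u \<and> \<not> E x v} T" if "E u v" "u \<in> V" "v \<in> V" for u v
    by (rule IH(1)) (use induced_matching_extend[OF E that] M(1) in auto)
  have nonedge: "cocolourable E {x \<in> V. E x u \<and> E x v} T" if "co E u v" "u \<in> V" "v \<in> V" for u v
  proof (rule cocolourable_mono)
    show "cocolourable E {x \<in> V. \<not> co E x u \<and> \<not> co E x v} T"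
      by (rule IH(2)) (use induced_matching_extend[OF simple_rel_co[OF E] that] M(2) in auto)
  qed (auto simp: co_def)
  have cos: "co E a c" "co E a d" "co E b c" "co E b d"
    using abcd sym unfolding co_def by metis+
  \<comment> \<open>After the first two tests, a vertex not adjacent to \<open>a\<close> is adjacent
    to \<open>b\<close>, and one not adjacent to \<open>c\<close> is adjacent to
    \<open>d\<close>.\<close>
  define f :: "_ \<Rightarrow> nat" where "f x = (if \<not> E x a \<and> \<not> E x b then 0 else if \<not> E x c \<and> \<not> E x d then 1
    else if E x a then (if E x c then 2 else 3) else (if E x c then 4 else 5))" for x
  show ?thesis
  proof (rule cocolourable_cover[where f = f])
    fix i :: nat assume "i < 6"
    then consider "i = 0" | "i = 1" | "i = 2" | "i = 3" | "i = 4" | "i = 5"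
      by linarith
    then show "cocolourable E {x \<in> V. f x = i} T"
    proof cases
      case 1
      show ?thesis
        by (rule cocolourable_mono[OF edge[of a b]]) (use abcd 1 in \<open>auto simp: f_def split: if_splits\<close>)
    next
      case 2
      show ?thesis
        by (rule cocolourable_mono[OF edge[of c d]]) (use abcd 2 in \<open>auto simp: f_def split: if_splits\<close>)
    next
      case 3
      show ?thesis
        by (rule cocolourable_mono[OF nonedge[of a c]]) (use abcd cos 3 in \<open>auto simp: f_def split: if_splits\<close>)
    next
      case 4
      show ?thesis
        by (rule cocolourable_mono[OF nonedge[of a d]]) (use abcd cos 4 in \<open>auto simp: f_def split: if_splits\<close>)
    next
      case 5
      show ?thesis
        by (rule cocolourable_mono[OF nonedge[of b c]]) (use abcd cos 5 in \<open>auto simp: f_def split: if_splits\<close>)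
    next
      case 6
      show ?thesis
        by (rule cocolourable_mono[OF nonedge[of b d]]) (use abcd cos 6 in \<open>auto simp: f_def split: if_splits\<close>)
    qed
  qed (simp add: f_def)
qed

text \<open>Induction on a bound for \<open>p + q\<close>. An induced C4 is a 2K2 of the complement,
  with \<open>p\<close> and \<open>q\<close> exchanged, and \<open>6 * T + 3\<close> covers these
  two cases as well as the three classes of \<open>cocolourable_2K2_free\<close>.\<close>

lemma bounded_cocolouring:
  "\<exists>T. \<forall>(E :: 'v \<Rightarrow> 'v \<Rightarrow> bool) V p q. p + q \<le> s \<longrightarrow> finite V \<longrightarrow> simple_rel E \<longrightarrow>
     \<not> induced_matching E V p \<longrightarrow> \<not> induced_matching (co E) V q \<longrightarrow> cocolourable E V T"
proof (induction s)
  case 0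
  then show ?case
    using induced_matching_0 by auto
next
  case (Suc s)
  then obtain T where T: "\<And>(E :: 'v \<Rightarrow> 'v \<Rightarrow> bool) V p q. p + q \<le> s \<Longrightarrow> finite V \<Longrightarrow> simple_rel E \<Longrightarrow>
     \<not> induced_matching E V p \<Longrightarrow> \<not> induced_matching (co E) V q \<Longrightarrow> cocolourable E V T"
    by blast
  have "cocolourable E V (6 * T + 3)"
    if pq: "p + q \<le> Suc s" and V: "finite V" and E: "simple_rel E"
      and M: "\<not> induced_matching E V p" "\<not> induced_matching (co E) V q"
    for E :: "'v \<Rightarrow> 'v \<Rightarrow> bool" and V p q
  proof -
    obtain p' q' where pq': "p = Suc p'" "q = Suc q'"
      using M induced_matching_0 by (metis not0_implies_Suc)
    have IH: "cocolourable E W T" if "W \<subseteq> V" "\<not> induced_matching E W p' \<or> \<not> induced_matching (co E) W q'" for W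
    proof -
      have "finite W" "\<not> induced_matching E W p" "\<not> induced_matching (co E) W q"
        using finite_subset[OF that(1) V] induced_matching_antimono[OF _ that(1)] M by blast+
      then show ?thesis
        using that(2) T[of p' q W E] T[of p q' W E] pq E unfolding pq' by auto
    qed
    consider "has_2K2 E V" | "has_2K2 (co E) V" | "\<not> has_2K2 E V" "\<not> has_2K2 (co E) V"
      by blast
    then show ?thesis
    proof cases
      case 1
      have "cocolourable E V (6 * T)"
        by (rule cocolourable_2K2[OF E M[unfolded pq'] _ _ 1]; rule IH; simp)
      then show ?thesis
        by (rule cocolourable_mono) auto
    next
      case 2
      have "cocolourable (co E) V (6 * T)"
      proof (rule cocolourable_2K2[OF simple_rel_co[OF E] M(2)[unfolded pq'(2)] _ _ _ 2])
        show "\<not> induced_matching (co (co E)) V (Suc p')"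
          using M(1) by (simp add: co_co[OF E] pq')
        fix W assume W: "W \<subseteq> V"
        show "cocolourable (co E) W T" if "\<not> induced_matching (co E) W q'"
          using IH[OF W] that by (simp add: cocolourable_co[OF E])
        show "cocolourable (co E) W T" if "\<not> induced_matching (co (co E)) W p'"
          using IH[OF W] that by (simp add: cocolourable_co[OF E] co_co[OF E])
      qed
      then show ?thesis
        unfolding cocolourable_co[OF E] by (rule cocolourable_mono) auto
    next
      case 3
      have "cocolourable E V 3"
        using V E 3 by (rule cocolourable_2K2_free)
      then show ?thesis
        by (rule cocolourable_mono) auto
    qed
  qed
  then show ?case
    by blast
qed

section \<open>Excluded induced subgraphs\<close>

text \<open>The flags tell whether the centres and the leaves form cliques, and whether the two
  sides are joined by a matching or by its bipartite complement. Complementing a graph negates all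
  three flags, so the eight forbidden graphs can be treated uniformly.\<close>

fun star_adj :: "bool \<Rightarrow> bool \<Rightarrow> bool \<Rightarrow> nat + nat \<Rightarrow> nat + nat \<Rightarrow> bool" where
  "star_adj cc ll e (Inl i) (Inl j) \<longleftrightarrow> cc \<and> i \<noteq> j"
| "star_adj cc ll e (Inr i) (Inr j) \<longleftrightarrow> ll \<and> i \<noteq> j"
| "star_adj cc ll e (Inl i) (Inr j) \<longleftrightarrow> (i = j) = e"
| "star_adj cc ll e (Inr i) (Inl j) \<longleftrightarrow> (i = j) = e"

definition star_graph :: "bool \<Rightarrow> bool \<Rightarrow> bool \<Rightarrow> nat \<Rightarrow> (nat + nat) pair_pre_digraph" where
  "star_graph cc ll e n =
     \<lparr> pverts = centres n \<union> leaves n,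
       parcs = {(u, v). u \<in> centres n \<union> leaves n \<and> v \<in> centres n \<union> leaves n \<and> star_adj cc ll e u v} \<rparr>"

lemma mem_centres_leaves [simp]:
  "Inl i \<in> centres n \<longleftrightarrow> i < n" "Inr i \<notin> centres n" "Inr i \<in> leaves n \<longleftrightarrow> i < n" "Inl i \<notin> leaves n"
  unfolding centres_def leaves_def by auto

lemma star_graph_eqI:
  assumes "pverts G = centres n \<union> leaves n"
    "\<And>u v. (u, v) \<in> parcs G \<longleftrightarrow> u \<in> centres n \<union> leaves n \<and> v \<in> centres n \<union> leaves n \<and> star_adj cc ll e u v"
  shows "G = star_graph cc ll e n"
  by (rule pair_pre_digraph.equality) (use assms in \<open>auto simp: star_graph_def\<close>)

lemma G_star_graph:
  "G1 n = star_graph False False True n" "G2 n = star_graph True False True n"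
  "G3 n = star_graph False True True n" "G4 n = star_graph True True True n"
proof -
  have G1: "(u, v) \<in> parcs (G1 n) \<longleftrightarrow>
      u \<in> centres n \<union> leaves n \<and> v \<in> centres n \<union> leaves n \<and> star_adj False False True u v" for u v
    unfolding G1_def by (cases u; cases v) auto
  have G1_verts: "pverts (G1 n) = centres n \<union> leaves n"
    unfolding G1_def by simp
  note defs = G2_def G3_def G4_def add_all_edges_def
  show "G1 n = star_graph False False True n"
    using G1_verts G1 by (rule star_graph_eqI)
  show "G2 n = star_graph True False True n"
  proof (rule star_graph_eqI)
    show "(u, v) \<in> parcs (G2 n) \<longleftrightarrow>
      u \<in> centres n \<union> leaves n \<and> v \<in> centres n \<union> leaves n \<and> star_adj True False True u v" for u v
      by (cases u; cases v) (simp_all add: defs G1, blast?)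
  qed (simp add: defs G1_verts)
  show "G3 n = star_graph False True True n"
  proof (rule star_graph_eqI)
    show "(u, v) \<in> parcs (G3 n) \<longleftrightarrow>
      u \<in> centres n \<union> leaves n \<and> v \<in> centres n \<union> leaves n \<and> star_adj False True True u v" for u v
      by (cases u; cases v) (simp_all add: defs G1, blast?)
  qed (simp add: defs G1_verts)
  show "G4 n = star_graph True True True n"
  proof (rule star_graph_eqI)
    show "(u, v) \<in> parcs (G4 n) \<longleftrightarrow>
      u \<in> centres n \<union> leaves n \<and> v \<in> centres n \<union> leaves n \<and> star_adj True True True u v" for u v
      by (cases u; cases v) (simp_all add: defs G1, blast?)
  qed (simp add: defs G1_verts)
qed

lemma complement_star_graph:
  "complement_graph (star_graph cc ll e n) = star_graph (\<not> cc) (\<not> ll) (\<not> e) n"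
proof (rule star_graph_eqI)
  show "(u, v) \<in> parcs (complement_graph (star_graph cc ll e n)) \<longleftrightarrow>
      u \<in> centres n \<union> leaves n \<and> v \<in> centres n \<union> leaves n \<and> star_adj (\<not> cc) (\<not> ll) (\<not> e) u v" for u v
    by (cases u; cases v) (simp_all add: complement_graph_def star_graph_def, blast+)
qed (simp add: complement_graph_def star_graph_def)

text \<open>The four flag choices with \<open>e\<close> true are the graphs \<open>G1\<close> to
  \<open>G4\<close>; each choice with \<open>e\<close> false is the complement of the one with all
  flags negated.\<close>

lemma star_graph_forbidden: "star_graph cc ll e n \<in> forbidden_family n"
proof -
  have True_case: "star_graph cc ll True n \<in> {G1 n, G2 n, G3 n, G4 n}" for cc ll
    unfolding G_star_graph by (cases cc; cases ll) simp_all
  show ?thesis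
  proof (cases e)
    case True
    then show ?thesis
      unfolding forbidden_family_def using True_case[of cc ll] by simp
  next
    case False
    then have "star_graph cc ll e n = complement_graph (star_graph (\<not> cc) (\<not> ll) True n)"
      by (simp add: complement_star_graph)
    also have "\<dots> \<in> complement_graph ` {G1 n, G2 n, G3 n, G4 n}"
      by (rule imageI[OF True_case])
    finally show ?thesis
      unfolding forbidden_family_def by (rule UnI2)
  qed
qed

text \<open>The image of \<open>H\<close> under \<open>f\<close> is the induced copy: since
  adjacency is preserved and reflected, its arcs are exactly the arcs of \<open>G\<close> between
  image vertices.\<close>

lemma contains_inducedI:
  assumes G: "pair_wf_digraph G" and H: "pair_wf_digraph H"
    and f: "inj_on f (pverts H)" "f ` pverts H \<subseteq> pverts G"
    and arcs: "\<And>u v. u \<in> pverts H \<Longrightarrow> v \<in> pverts H \<Longrightarrow> (f u, f v) \<in> parcs G \<longleftrightarrow> (u, v) \<in> parcs H"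
  shows "contains_induced G H"
proof -
  interpret G: pair_wf_digraph G by (rule G)
  interpret H: pair_wf_digraph H by (rule H)
  let ?hom = "\<lparr>iso_verts = f, iso_arcs = map_prod f f, iso_head = snd, iso_tail = fst\<rparr>"
  let ?K = "app_iso ?hom (with_proj H)"
  have Hin: "u \<in> pverts H" "v \<in> pverts H" if "(u, v) \<in> parcs H" for u v
    using H.in_arcsD1 H.in_arcsD2 that by blast+
  have "inj_on (map_prod f f) (pverts H \<times> pverts H)"
    using f(1) by (rule map_prod_inj_on[OF _ f(1)])
  then have "inj_on (map_prod f f) (parcs H)"
    by (rule inj_on_subset) (use Hin in auto)
  then have hom: "pre_digraph.digraph_isomorphism (with_proj H) ?hom"
    unfolding H.digraph_isomorphism_def using f(1) H.wf_digraph_axioms by (auto simp: H.wf_digraph)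
  have arcs_K: "map_prod f f ` parcs H =
      {e \<in> parcs G. fst e \<in> f ` pverts H \<and> snd e \<in> f ` pverts H}"
  proof (intro subset_antisym subsetI)
    fix e assume "e \<in> map_prod f f ` parcs H"
    then obtain u v where "(u, v) \<in> parcs H" "e = (f u, f v)"
      by auto
    then show "e \<in> {e \<in> parcs G. fst e \<in> f ` pverts H \<and> snd e \<in> f ` pverts H}"
      using arcs Hin by auto
  next
    fix e assume "e \<in> {e \<in> parcs G. fst e \<in> f ` pverts H \<and> snd e \<in> f ` pverts H}"
    then obtain u v where uv: "u \<in> pverts H" "v \<in> pverts H" "e = (f u, f v)" "e \<in> parcs G"
      by (cases e) auto
    then have "(u, v) \<in> parcs H"
      using arcs by blast
    then show "e \<in> map_prod f f ` parcs H"
      using uv(3) by (metis map_prod_imageI)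
  qed
  have "induced_subgraph ?K (with_proj G)"
    unfolding induced_subgraph_def subgraph_def compatible_def
  proof (intro conjI)
    show "wf_digraph ?K"
      using hom by (rule H.wf_digraphI_app_iso)
    show "wf_digraph (with_proj G)"
      by (rule G.wf_digraph)
    show "verts ?K \<subseteq> verts (with_proj G)"
      using f(2) by simp
    show "arcs ?K \<subseteq> arcs (with_proj G)"
      using arcs_K by auto
    show "arcs ?K = {e \<in> arcs (with_proj G). tail (with_proj G) e \<in> verts ?K \<and>
        head (with_proj G) e \<in> verts ?K}"
      using arcs_K by simp
  qed simp_all
  moreover have "digraph_iso (with_proj H) ?K"
    unfolding digraph_iso_def using hom by blast
  ultimately show ?thesis
    unfolding contains_induced_def by blast
qed

text \<open>A digraph isomorphism also relabels arcs, tails and heads. The copy is a subgraph of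
  \<open>G\<close>, so its tail and head maps are \<open>fst\<close> and \<open>snd\<close>, and the
  vertex map determines the arc map.\<close>

lemma contains_inducedE:
  assumes "contains_induced G H"
  obtains f where "f ` pverts H \<subseteq> pverts G"
    "\<And>u v. u \<in> pverts H \<Longrightarrow> v \<in> pverts H \<Longrightarrow> (f u, f v) \<in> parcs G \<longleftrightarrow> (u, v) \<in> parcs H"
proof -
  obtain h where ind: "induced_subgraph (app_iso h (with_proj H)) (with_proj G)"
    and hom: "pre_digraph.digraph_isomorphism (with_proj H) h"
    using assms unfolding contains_induced_def digraph_iso_def by blast
  let ?f = "iso_verts h"
  have inj: "inj_on ?f (pverts H)"
    and ends: "?f (fst e) = iso_tail h (iso_arcs h e)" "?f (snd e) = iso_head h (iso_arcs h e)"
    if "e \<in> parcs H" for e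
    using hom that unfolding pre_digraph.digraph_isomorphism_def by auto
  have sub: "?f ` pverts H \<subseteq> pverts G" and tl: "iso_tail h = fst" "iso_head h = snd"
    and arcs: "iso_arcs h ` parcs H = {e \<in> parcs G. fst e \<in> ?f ` pverts H \<and> snd e \<in> ?f ` pverts H}"
    using ind unfolding induced_subgraph_def subgraph_def compatible_def by auto
  have wf: "wf_digraph (with_proj H)"
    using hom unfolding pre_digraph.digraph_isomorphism_def by blast
  have Hwf: "fst e \<in> pverts H" "snd e \<in> pverts H" if "e \<in> parcs H" for e
    using wf_digraph.tail_in_verts[OF wf, of e] wf_digraph.head_in_verts[OF wf, of e] that by simp_all
  have im: "iso_arcs h e = (?f (fst e), ?f (snd e))" if "e \<in> parcs H" for e
    using ends[OF that] unfolding tl by (simp add: prod_eq_iff)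
  have "(?f u, ?f v) \<in> parcs G \<longleftrightarrow> (u, v) \<in> parcs H" if uv: "u \<in> pverts H" "v \<in> pverts H" for u v
  proof
    assume "(u, v) \<in> parcs H"
    then have "(?f u, ?f v) \<in> iso_arcs h ` parcs H"
      using im[of "(u, v)"] by (metis fst_conv imageI snd_conv)
    then show "(?f u, ?f v) \<in> parcs G"
      unfolding arcs by simp
  next
    assume "(?f u, ?f v) \<in> parcs G"
    then have "(?f u, ?f v) \<in> iso_arcs h ` parcs H"
      unfolding arcs using uv by simp
    then obtain e where e: "e \<in> parcs H" "iso_arcs h e = (?f u, ?f v)"
      by auto
    then have "?f (fst e) = ?f u" "?f (snd e) = ?f v"
      using im[OF e(1)] by auto
    then have "fst e = u" "snd e = v"
      using inj_onD[OF inj[OF e(1)]] uv Hwf[OF e(1)] by auto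
    then show "(u, v) \<in> parcs H"
      using e(1) by auto
  qed
  then show ?thesis
    using that sub by blast
qed

section \<open>Forbidden graphs from matchings and homogeneous sets\<close>

lemma simple_rel_parcs:
  assumes "pair_graph G"
  shows "simple_rel (\<lambda>u v. (u, v) \<in> parcs G)"
proof -
  interpret pair_graph G by (rule assms)
  show ?thesis
    unfolding simple_rel_def using arcs_symmetric pair_no_loops by fastforce
qed

lemma contains_star_graph:
  assumes G: "pair_graph G"
    and verts: "\<And>i. i < n \<Longrightarrow> a i \<in> pverts G" "\<And>i. i < n \<Longrightarrow> b i \<in> pverts G"
    and ab: "\<And>i j. i < n \<Longrightarrow> j < n \<Longrightarrow> (a i, b j) \<in> parcs G \<longleftrightarrow> (i = j) = e"
    and aa: "\<And>i j. i < n \<Longrightarrow> j < n \<Longrightarrow> i \<noteq> j \<Longrightarrow> a i \<noteq> a j \<and> ((a i, a j) \<in> parcs G \<longleftrightarrow> cc)"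
    and bb: "\<And>i j. i < n \<Longrightarrow> j < n \<Longrightarrow> i \<noteq> j \<Longrightarrow> b i \<noteq> b j \<and> ((b i, b j) \<in> parcs G \<longleftrightarrow> ll)"
    and disj: "\<And>i j. i < n \<Longrightarrow> j < n \<Longrightarrow> a i \<noteq> b j"
  shows "contains_induced G (star_graph cc ll e n)"
proof -
  interpret G: pair_graph G by (rule G)
  have simple: "simple_rel (\<lambda>u v. (u, v) \<in> parcs G)"
    using G by (rule simple_rel_parcs)
  let ?f = "case_sum a b"
  show ?thesis
  proof (rule contains_inducedI)
    show "pair_wf_digraph G"
      by (rule G.pair_wf_digraph)
    show "pair_wf_digraph (star_graph cc ll e n)"
      by unfold_locales (auto simp: star_graph_def)
    show "inj_on ?f (pverts (star_graph cc ll e n))"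
    proof (rule inj_onI)
      fix u v assume "u \<in> pverts (star_graph cc ll e n)" "v \<in> pverts (star_graph cc ll e n)" "?f u = ?f v"
      then show "u = v"
        using aa bb disj by (cases u; cases v) (auto simp: star_graph_def, metis+)
    qed
    show "?f ` pverts (star_graph cc ll e n) \<subseteq> pverts G"
      using verts by (auto simp: star_graph_def centres_def leaves_def)
    fix u v assume uv: "u \<in> pverts (star_graph cc ll e n)" "v \<in> pverts (star_graph cc ll e n)"
    have "(?f u, ?f v) \<in> parcs G \<longleftrightarrow> star_adj cc ll e u v"
    proof (cases u; cases v)
      fix i j assume "u = Inl i" "v = Inl j"
      then show ?thesis
        using uv aa[of i j] simple by (cases "i = j") (auto simp: star_graph_def simple_rel_def)
    next
      fix i j assume "u = Inr i" "v = Inr j"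
      then show ?thesis
        using uv bb[of i j] simple by (cases "i = j") (auto simp: star_graph_def simple_rel_def)
    next
      fix i j assume "u = Inl i" "v = Inr j"
      then show ?thesis
        using uv ab[of i j] by (simp add: star_graph_def)
    next
      fix i j assume "u = Inr i" "v = Inl j"
      moreover have "(b i, a j) \<in> parcs G \<longleftrightarrow> (a j, b i) \<in> parcs G"
        using simple unfolding simple_rel_def by blast
      ultimately show ?thesis
        using uv ab[of j i] by (auto simp: star_graph_def)
    qed
    then show "(?f u, ?f v) \<in> parcs G \<longleftrightarrow> (u, v) \<in> parcs (star_graph cc ll e n)"
      using uv by (simp add: star_graph_def)
  qed
qed

lemma contains_star_graph_matching:
  assumes G: "pair_graph G" and "induced_matching (\<lambda>u v. (u, v) \<in> parcs G) (pverts G) n"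
  shows "contains_induced G (star_graph False False True n)"
proof -
  obtain a b where V: "\<forall>i<n. a i \<in> pverts G" "\<forall>i<n. b i \<in> pverts G"
    and ab': "\<forall>i<n. \<forall>j<n. (a i, b j) \<in> parcs G \<longleftrightarrow> i = j"
      "\<forall>i<n. \<forall>j<n. (a i, a j) \<notin> parcs G" "\<forall>i<n. \<forall>j<n. (b i, b j) \<notin> parcs G"
    using assms(2) by (rule induced_matchingE)
  note ab = ab'[rule_format]
  show ?thesis
  proof (rule contains_star_graph[OF G, of n a b])
    fix i j assume ij: "i < n" "j < n"
    show "a i \<noteq> b j"
      using ab(1)[of i i] ab(3)[of j i] ij by metis
    show "a i \<noteq> a j \<and> ((a i, a j) \<in> parcs G \<longleftrightarrow> False)" if "i \<noteq> j"
      using ab(1)[of i i] ab(1)[of j i] ab(2)[of i j] ij that by auto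
    show "b i \<noteq> b j \<and> ((b i, b j) \<in> parcs G \<longleftrightarrow> False)" if "i \<noteq> j"
      using ab(1)[of i i] ab(1)[of i j] ab(3)[of i j] ij that by auto
    show "(a i, b j) \<in> parcs G \<longleftrightarrow> (i = j) = True"
      using ab(1)[OF ij] by simp
  qed (use V in auto)
qed

lemma contains_star_graph_comatching:
  assumes G: "pair_graph G" and "induced_matching (co (\<lambda>u v. (u, v) \<in> parcs G)) (pverts G) n"
  shows "contains_induced G (star_graph True True False n)"
proof -
  let ?E = "\<lambda>u v. (u, v) \<in> parcs G"
  obtain a b where V: "\<forall>i<n. a i \<in> pverts G" "\<forall>i<n. b i \<in> pverts G"
    and ab': "\<forall>i<n. \<forall>j<n. co ?E (a i) (b j) \<longleftrightarrow> i = j"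
      "\<forall>i<n. \<forall>j<n. \<not> co ?E (a i) (a j)" "\<forall>i<n. \<forall>j<n. \<not> co ?E (b i) (b j)"
    using assms(2) by (rule induced_matchingE)
  note ab = ab'[rule_format]
  have ne: "a i \<noteq> b j" if "i < n" "j < n" for i j
    using ab(1)[of i i] ab(3)[of j i] that by metis
  show ?thesis
  proof (rule contains_star_graph[OF G, of n a b])
    fix i j assume ij: "i < n" "j < n"
    show "a i \<noteq> b j"
      using ne ij by blast
    show "a i \<noteq> a j \<and> ((a i, a j) \<in> parcs G \<longleftrightarrow> True)" if "i \<noteq> j"
    proof -
      have "a i \<noteq> a j"
        using ab(1)[of i i] ab(1)[of j i] ij that by metis
      then show ?thesis
        using ab(2)[OF ij] unfolding co_def by simp
    qed
    show "b i \<noteq> b j \<and> ((b i, b j) \<in> parcs G \<longleftrightarrow> True)" if "i \<noteq> j"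
    proof -
      have "b i \<noteq> b j"
        using ab(1)[of i i] ab(1)[of i j] ij that by metis
      then show ?thesis
        using ab(3)[OF ij] unfolding co_def by simp
    qed
    show "(a i, b j) \<in> parcs G \<longleftrightarrow> (i = j) = False"
      using ab(1)[OF ij] ne[OF ij] unfolding co_def by blast
  qed (use V in auto)
qed

text \<open>Homogeneity makes adjacency constant inside each side but does not tell which constant
  it is, so the flags are existential. The cross adjacencies keep the \<open>a i\<close> distinct,
  and the \<open>b i\<close> likewise.\<close>

lemma contains_star_graph_homogeneous:
  assumes G: "pair_graph G" and AB: "A \<subseteq> pverts G" "B \<subseteq> pverts G" "A \<inter> B = {}"
    and hom: "homogeneous (\<lambda>u v. (u, v) \<in> parcs G) A" "homogeneous (\<lambda>u v. (u, v) \<in> parcs G) B"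
    and ab: "\<forall>i<n. a i \<in> A" "\<forall>i<n. b i \<in> B" "\<And>i j. i < n \<Longrightarrow> j < n \<Longrightarrow> (a i, b j) \<in> parcs G \<longleftrightarrow> (i = j) = e"
  shows "\<exists>cc ll. contains_induced G (star_graph cc ll e n)"
proof -
  obtain cc where cc: "\<And>x y. x \<in> A \<Longrightarrow> y \<in> A \<Longrightarrow> x \<noteq> y \<Longrightarrow> (x, y) \<in> parcs G \<longleftrightarrow> cc"
    using hom(1) unfolding homogeneous_def by blast
  obtain ll where ll: "\<And>x y. x \<in> B \<Longrightarrow> y \<in> B \<Longrightarrow> x \<noteq> y \<Longrightarrow> (x, y) \<in> parcs G \<longleftrightarrow> ll"
    using hom(2) unfolding homogeneous_def by blast
  have "contains_induced G (star_graph cc ll e n)"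
  proof (rule contains_star_graph[OF G, of n a b])
    fix i j assume ij: "i < n" "j < n"
    show "a i \<noteq> b j"
      using ab(1,2) ij AB(3) by auto
    show "a i \<noteq> a j \<and> ((a i, a j) \<in> parcs G \<longleftrightarrow> cc)" if "i \<noteq> j"
    proof -
      have "a i \<noteq> a j"
        using ab(3)[of i i] ab(3)[of j i] ij that by metis
      then show ?thesis
        using cc ab(1) ij by simp
    qed
    show "b i \<noteq> b j \<and> ((b i, b j) \<in> parcs G \<longleftrightarrow> ll)" if "i \<noteq> j"
    proof -
      have "b i \<noteq> b j"
        using ab(3)[of i i] ab(3)[of i j] ij that by metis
      then show ?thesis
        using ll ab(2) ij by simp
    qed
    show "(a i, b j) \<in> parcs G \<longleftrightarrow> (i = j) = e"
      using ab(3)[OF ij] .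
  qed (use ab(1,2) AB(1,2) in auto)
  then show ?thesis
    by blast
qed

lemma induces_clique_or_independent:
  assumes G: "pair_graph G" and V: "V \<subseteq> pverts G" and hom: "homogeneous (\<lambda>u v. (u, v) \<in> parcs G) V"
  shows "induces_clique G V \<or> induces_independent G V"
proof -
  interpret G: pair_graph G by (rule G)
  let ?H = "\<lparr> pverts = V, parcs = {e \<in> parcs G. fst e \<in> V \<and> snd e \<in> V} \<rparr>"
  \<comment> \<open>Written as an explicit pair graph, the induced subgraph fits
    \<open>complete_digraph_pair_def\<close>.\<close>
  have H: "with_proj G \<restriction> V = with_proj ?H"
    unfolding induce_subgraph_def with_proj_def by simp
  have irr: "(x, x) \<notin> parcs G" for x
    using simple_rel_parcs[OF G] unfolding simple_rel_def by blast
  have fin: "finite V"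
    using V G.pair_finite_verts finite_subset by blast
  consider "\<forall>x\<in>V. \<forall>y\<in>V. x \<noteq> y \<longrightarrow> (x, y) \<in> parcs G" | "\<forall>x\<in>V. \<forall>y\<in>V. (x, y) \<notin> parcs G"
    using hom unfolding homogeneous_def by blast
  then show ?thesis
  proof cases
    case 1
    then have "parcs ?H = {(u, v). (u, v) \<in> V \<times> V \<and> u \<noteq> v}"
      using irr by auto
    then have "induces_clique G V"
      unfolding induces_clique_def H complete_digraph_pair_def using fin by simp
    then show ?thesis ..
  next
    case 2
    then have "induces_independent G V"
      unfolding induces_independent_def H by auto
    then show ?thesis ..
  qed
qed

text \<open>Each of the two edges may start in \<open>V\<close> or in \<open>W\<close>; symmetry of
  \<open>G\<close> turns all four cases into \<open>free\<close>. Only non-edges across the sides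
  are used, and those are non-edges of \<open>G\<close> itself.\<close>

lemma twoK2_freeI:
  assumes G: "pair_graph G" and disj: "V \<inter> W = {}"
    and free: "\<And>v v' w w'. v \<in> V \<Longrightarrow> v' \<in> V \<Longrightarrow> w \<in> W \<Longrightarrow> w' \<in> W \<Longrightarrow> (v, w) \<in> parcs G \<Longrightarrow>
      (v', w') \<in> parcs G \<Longrightarrow> (v, w') \<notin> parcs G \<Longrightarrow> (v', w) \<notin> parcs G \<Longrightarrow> False"
  shows "twoK2_free (bipartite_between G V W)"
  unfolding twoK2_free_def
proof
  assume "contains_induced (bipartite_between G V W) (G1 2)"
  then obtain f where f: "\<And>u v. u \<in> pverts (G1 2) \<Longrightarrow> v \<in> pverts (G1 2) \<Longrightarrow>
      (f u, f v) \<in> parcs (bipartite_between G V W) \<longleftrightarrow> (u, v) \<in> parcs (G1 2)"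
    by (rule contains_inducedE) blast
  let ?B = "parcs (bipartite_between G V W)"
  have mem: "Inl 0 \<in> pverts (G1 2)" "Inl 1 \<in> pverts (G1 2)" "Inr 0 \<in> pverts (G1 2)" "Inr 1 \<in> pverts (G1 2)"
    unfolding G_star_graph star_graph_def by simp_all
  define x x' y y' where "x = f (Inl 0)" and "x' = f (Inl 1)" and "y = f (Inr 0)" and "y' = f (Inr 1)"
  note xy = x_def x'_def y_def y'_def
  have edges: "(x, y) \<in> ?B" "(x', y') \<in> ?B"
    and nonedges: "(x, y') \<notin> ?B" "(x', y) \<notin> ?B" "(x, x') \<notin> ?B"
      "(y', y) \<notin> ?B" "(y, y') \<notin> ?B" "(x', x) \<notin> ?B" "(y, x') \<notin> ?B" "(y', x) \<notin> ?B"
    unfolding xy using f mem by (simp_all add: G_star_graph star_graph_def)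
  have sym: "(u, v) \<in> parcs G \<longleftrightarrow> (v, u) \<in> parcs G" for u v
    using simple_rel_parcs[OF G] unfolding simple_rel_def by blast
  have B: "(u, v) \<in> ?B \<longleftrightarrow> (u, v) \<in> parcs G \<and> (u \<in> V \<and> v \<in> W \<or> u \<in> W \<and> v \<in> V)" for u v
    unfolding bipartite_between_def by auto
  consider "x \<in> V" "y \<in> W" "x' \<in> V" "y' \<in> W" | "x \<in> V" "y \<in> W" "x' \<in> W" "y' \<in> V"
    | "x \<in> W" "y \<in> V" "x' \<in> V" "y' \<in> W" | "x \<in> W" "y \<in> V" "x' \<in> W" "y' \<in> V"
    using edges unfolding B by blast
  then show False
  proof cases
    case 1
    then show False
      using free[of x x' y y'] edges nonedges unfolding B by blast
  next
    case 2
    then show False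
      using free[of x y' y x'] edges nonedges sym[of y' x'] unfolding B by blast
  next
    case 3
    then show False
      using free[of y x' x y'] edges nonedges sym[of y x] unfolding B by blast
  next
    case 4
    then show False
      using free[of y y' x x'] edges nonedges sym[of y x] sym[of y' x'] unfolding B by blast
  qed
qed

section \<open>Refinement of the homogeneous classes\<close>

theorem theorem2:
  fixes n :: nat
  shows "\<exists>T::nat. \<forall>G :: 'a pair_pre_digraph.
           pair_graph G \<longrightarrow> (\<forall>H\<in>forbidden_family n. \<not> contains_induced G H) \<longrightarrow>
           (\<exists>P. partition_on (pverts G) P \<and> card P \<le> T \<and>
                (\<forall>V\<in>P. induces_clique G V \<or> induces_independent G V) \<and>
                (\<forall>V\<in>P. \<forall>W\<in>P. V \<noteq> W \<longrightarrow> twoK2_free (bipartite_between G V W)))"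
proof -
  \<comment> \<open>Matchings and co-matchings are both excluded at size \<open>n\<close>, hence the
    bound \<open>n + n\<close>. Both constants are fixed before \<open>G\<close>.\<close>
  obtain C where C: "\<And>(E :: 'a \<Rightarrow> 'a \<Rightarrow> bool) V p q. p + q \<le> n + n \<Longrightarrow> finite V \<Longrightarrow> simple_rel E \<Longrightarrow>
     \<not> induced_matching E V p \<Longrightarrow> \<not> induced_matching (co E) V q \<Longrightarrow> cocolourable E V C"
    using bounded_cocolouring[where 'v = 'a, of "n + n"] by blast
  obtain B where B: "\<And>(D :: 'a \<Rightarrow> 'a \<Rightarrow> bool) X Y p q. p + q \<le> n + n \<Longrightarrow> bip_tournament D X Y \<Longrightarrow>
     \<not> pattern D X Y p \<Longrightarrow> \<not> pattern D Y X q \<Longrightarrow> colourable D X Y B"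
    using bip_tournament_colourable[where 'v = 'a, of "n + n"] by blast
  define I where "I = {(i, j). i < C \<and> j < C \<and> i \<noteq> j}"
  have finI: "finite I"
    by (rule finite_subset[of _ "{..<C} \<times> {..<C}"]) (auto simp: I_def)
  have "\<exists>P. partition_on (pverts G) P \<and> card P \<le> C * B ^ card I \<and>
                (\<forall>V\<in>P. induces_clique G V \<or> induces_independent G V) \<and>
                (\<forall>V\<in>P. \<forall>W\<in>P. V \<noteq> W \<longrightarrow> twoK2_free (bipartite_between G V W))"
    if G: "pair_graph G" and free: "\<forall>H\<in>forbidden_family n. \<not> contains_induced G H"
    for G :: "'a pair_pre_digraph"
  proof -
    interpret G: pair_graph G by (rule G)
    let ?E = "\<lambda>u v. (u, v) \<in> parcs G" and ?V = "pverts G"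
    have simple: "simple_rel ?E"
      using G by (rule simple_rel_parcs)
    then have sym: "?E u v \<longleftrightarrow> ?E v u" for u v
      unfolding simple_rel_def by blast
    have no_star: "\<not> contains_induced G (star_graph cc ll e n)" for cc ll e
      using free star_graph_forbidden by blast
    have "cocolourable ?E ?V C"
    proof (rule C[of n n])
      show "\<not> induced_matching ?E ?V n"
        using contains_star_graph_matching[OF G, of n] no_star by blast
      show "\<not> induced_matching (co ?E) ?V n"
        using contains_star_graph_comatching[OF G, of n] no_star by blast
    qed (use G.pair_finite_verts simple in simp_all)
    then obtain c :: "'a \<Rightarrow> nat" where c: "\<And>x. c x < C" "\<And>k. homogeneous ?E {x \<in> ?V. c x = k}"
      unfolding cocolourable_def by blast
    define X where "X k = {x \<in> ?V. c x = k}" for k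
    \<comment> \<open>Across the boundary of \<open>X k\<close>, edges are oriented away from
      \<open>X k\<close> and non-edges towards it.\<close>
    define D where "D k x y \<longleftrightarrow> (if x \<in> X k then ?E x y else \<not> ?E x y)" for k x y
    have "colourable (D i) (X i) (X j) B" if "i \<noteq> j" for i j
    proof (rule B[of n n])
      have XX: "X i \<inter> X j = {}"
        using that unfolding X_def by auto
      show "bip_tournament (D i) (X i) (X j)"
        unfolding bip_tournament_def
      proof (intro conjI ballI)
        show "finite (X i)" "finite (X j)"
          unfolding X_def using G.pair_finite_verts by simp_all
        fix x y assume "x \<in> X i" "y \<in> X j"
        then show "D i x y \<longleftrightarrow> \<not> D i y x"
          using XX sym[of x y] unfolding D_def by auto
      qed (rule XX)
      show "\<not> pattern (D i) (X i) (X j) n"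
      proof
        assume "pattern (D i) (X i) (X j) n"
        then obtain a b where ab: "\<forall>k<n. a k \<in> X i" "\<forall>k<n. b k \<in> X j"
          "\<forall>k<n. \<forall>l<n. D i (a k) (b l) \<longleftrightarrow> k = l"
          by (rule patternE)
        have "\<exists>cc ll. contains_induced G (star_graph cc ll True n)"
        proof (rule contains_star_graph_homogeneous[OF G _ _ XX _ _ ab(1,2)])
          show "?E (a k) (b l) \<longleftrightarrow> (k = l) = True" if "k < n" "l < n" for k l
            using ab that unfolding D_def by auto
        qed (use c(2) in \<open>auto simp: X_def\<close>)
        then show False
          using no_star by blast
      qed
      show "\<not> pattern (D i) (X j) (X i) n"
      proof
        assume "pattern (D i) (X j) (X i) n"
        then obtain a b where ab: "\<forall>k<n. a k \<in> X j" "\<forall>k<n. b k \<in> X i"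
          "\<forall>k<n. \<forall>l<n. D i (a k) (b l) \<longleftrightarrow> k = l"
          by (rule patternE)
        have "X j \<inter> X i = {}"
          using XX by blast
        then have "\<exists>cc ll. contains_induced G (star_graph cc ll False n)"
        proof (rule contains_star_graph_homogeneous[OF G _ _ _ _ _ ab(1,2), rotated 2])
          \<comment> \<open>From a vertex outside \<open>X i\<close> an arc means a non-edge, so
            this pattern is a co-matching and \<open>e\<close> is false.\<close>
          have "a k \<notin> X i" if "k < n" for k
            using ab(1) that XX by blast
          then show "?E (a k) (b l) \<longleftrightarrow> (k = l) = False" if "k < n" "l < n" for k l
            using ab(3) that unfolding D_def by auto
        qed (use c(2) in \<open>auto simp: X_def\<close>)
        then show False
          using no_star by blast
      qed
    qed simp
    then have "\<forall>ij\<in>I. \<exists>d :: 'a \<Rightarrow> nat. (\<forall>x. d x < B) \<and>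
        no_mono_cycle (D (fst ij)) (X (fst ij)) (X (snd ij)) d"
      unfolding I_def colourable_def by auto
    from bchoice[OF this] obtain d :: "nat \<times> nat \<Rightarrow> 'a \<Rightarrow> nat" where
      d: "\<forall>ij\<in>I. (\<forall>x. d ij x < B) \<and> no_mono_cycle (D (fst ij)) (X (fst ij)) (X (snd ij)) (d ij)"
      by blast
    \<comment> \<open>The parts are the fibres of \<open>h\<close>: the homogeneous class together
      with the colour for every ordered pair of classes. Restricting to \<open>I\<close> bounds the
      number of values.\<close>
    define h where "h x = (c x, restrict (\<lambda>ij. d ij x) I)" for x
    have h_eq: "c x = c y" "\<And>ij. ij \<in> I \<Longrightarrow> d ij x = d ij y" if "h x = h y" for x y
    proof -
      have eq: "restrict (\<lambda>ij. d ij x) I = restrict (\<lambda>ij. d ij y) I"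
        using that unfolding h_def by blast
      show "d ij x = d ij y" if "ij \<in> I" for ij
        using fun_cong[OF eq, of ij] that by (simp only: restrict_apply')
      show "c x = c y"
        using that unfolding h_def by blast
    qed
    let ?S = "{..<C} \<times> (I \<rightarrow>\<^sub>E {..<B})"
    have finS: "finite ?S"
      using finI by (intro finite_cartesian_product finite_PiE) auto
    have hS: "h ` ?V \<subseteq> ?S"
      unfolding h_def using c(1) d by auto
    define P where "P = (\<lambda>s. {x \<in> ?V. h x = s}) ` h ` ?V"
    have part: "partition_on ?V P"
      unfolding P_def partition_on_def disjoint_def by auto
    have "card P \<le> card (h ` ?V)"
      unfolding P_def using G.pair_finite_verts by (intro card_image_le) simp
    also have "\<dots> \<le> card ?S"
      using finS hS by (rule card_mono)
    also have "\<dots> = C * B ^ card I"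
      using finI by (simp add: card_cartesian_product card_PiE)
    finally have card: "card P \<le> C * B ^ card I" .
    have hom: "induces_clique G V \<or> induces_independent G V" if VP: "V \<in> P" for V
    proof (rule induces_clique_or_independent[OF G])
      obtain x where V: "V = {y \<in> ?V. h y = h x}"
        using VP unfolding P_def by blast
      show "V \<subseteq> ?V"
        using V by blast
      show "homogeneous ?E V"
        by (rule homogeneous_subset[OF c(2)[of "c x"]]) (use h_eq(1) V in blast)
    qed
    have chain: "twoK2_free (bipartite_between G V W)" if VW: "V \<in> P" "W \<in> P" "V \<noteq> W" for V W
    proof (rule twoK2_freeI[OF G])
      obtain x y where V: "V = {z \<in> ?V. h z = h x}" and W: "W = {z \<in> ?V. h z = h y}"
        using VW unfolding P_def by blast
      have ne: "h x \<noteq> h y"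
        using VW(3) unfolding V W by metis
      show VW_disj: "V \<inter> W = {}"
        unfolding V W using ne by auto
      fix v v' w w'
      assume mem: "v \<in> V" "v' \<in> V" "w \<in> W" "w' \<in> W"
        and arcs: "?E v w" "?E v' w'" "\<not> ?E v w'" "\<not> ?E v' w"
      have X: "v \<in> X (c x)" "v' \<in> X (c x)" "w \<in> X (c y)" "w' \<in> X (c y)"
        using mem h_eq(1) unfolding V W X_def by blast+
      show False
      proof (cases "c x = c y")
        \<comment> \<open>Both parts lie in one homogeneous class, where the edge \<open>v w\<close>
          and the non-edge \<open>v w'\<close> cannot coexist.\<close>
        case True
        have "homogeneous ?E (X (c x))" "v \<noteq> w'"
          using c(2) VW_disj mem unfolding X_def by auto
        then show False
          using X arcs unfolding True homogeneous_def by blast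
      next
        case False
        then have I: "(c x, c y) \<in> I"
          using c(1) unfolding I_def by simp
        have "h v = h v'" "h w = h w'"
          using mem unfolding V W by simp_all
        then have "d (c x, c y) v = d (c x, c y) v'" "d (c x, c y) w = d (c x, c y) w'"
          using h_eq(2) I by blast+
        moreover have "no_mono_cycle (D (c x)) (X (c x)) (X (c y)) (d (c x, c y))"
          using d I by fastforce
        \<comment> \<open>A 2K2 on \<open>v w\<close> and \<open>v' w'\<close> would be exactly this
          directed cycle.\<close>
        ultimately have "\<not> (D (c x) v w \<and> D (c x) w v' \<and> D (c x) v' w' \<and> D (c x) w' v)"
          using X unfolding no_mono_cycle_def by blast
        moreover have "w \<notin> X (c x)" "w' \<notin> X (c x)"
          using X(3,4) False unfolding X_def by auto
        ultimately show False
          using X(1,2) arcs sym unfolding D_def by auto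
      qed
    qed
    show ?thesis
      using part card hom chain by blast
  qed
  then show ?thesis
    by blast
qed

end
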